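(* Let $1\le n\le m$ be integers and $\mathbb{K}=\mathbb{R}$ or $\mathbb{C}$. The function $\alpha_2:\mathbb{P}(\mathbb{GL}_{n,m}^>)\to\mathbb{R}$, $\alpha_2(A)=\|A\|_F^2\,\sigma_n^{-2}(A)$, is self-convex in $\mathbb{P}(\mathbb{GL}_{n,m}^>)$.
   Context: The singular values of $A\in\mathbb{K}^{n\times m}$ are $\sigma_1(A)\ge\cdots\ge\sigma_n(A)\ge0$. $\mathbb{GL}_{n,m}^>$ is the open set of matrices $A\in\mathbb{K}^{n\times m}$ of rank $n$ with $\sigma_{n-1}(A)>\sigma_n(A)$ (the smallest singular value is simple). $\|\cdot\|_F$ is the norm of $\langle M,N\rangle_F=\mathrm{trace}(N^*M)$. $\mathbb{P}(\mathbb{GL}_{n,m}^>)$ is the image of $\mathbb{GL}_{n,m}^>$ in the projective space $\mathbb{P}(\mathbb{K}^{n\times m})$ (an open subset), and $\alpha_2$ is well defined since its formula is invariant under scaling of $A$ by $\mathbb{K}\setminus\{0\}$. The Riemannian metric on $\mathbb{P}(\mathbb{K}^{n\times m})$ is the unique one making the canonical projection from the unit sphere $\{\|A\|_F=1\}$ (with the metric induced by $\mathrm{Re}\langle\cdot,\cdot\rangle_F$) a Riemannian submersion. Self-convexity: let $(\mathcal{M},\langle\cdot,\cdot\rangle)$ be a Riemannian manifold and $\alpha:\mathcal{M}\to\mathbb{R}$ a $C^2$ function with positive values. Let $\mathcal{M}_\kappa$ be $\mathcal{M}$ with the new metric $\langle\cdot,\cdot\rangle_{\kappa,x}=\alpha(x)\langle\cdot,\cdot\rangle_x$.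 The function $\alpha$ is self-convex when $t\mapsto\log\alpha(\gamma(t))$ is convex for every geodesic $\gamma$ in $\mathcal{M}_\kappa$. *)

theory Defs
  imports "HOL-Analysis.Analysis"
begin

section \<open>The scalar fields\<close>

text \<open>
  The class below is only a device for treating the real and the complex case uniformly: its
  members are, up to isomorphism, \<open>\<real>\<close> and \<open>\<complex>\<close> with their usual conjugations and norms.
\<close>

class conj_field = real_normed_field + euclidean_space +
  fixes conjg :: "'a \<Rightarrow> 'a"
  assumes conjg_add: "conjg (x + y) = conjg x + conjg y"
    and conjg_mult: "conjg (x * y) = conjg x * conjg y"
    and conjg_conjg [simp]: "conjg (conjg x) = x"
    and mult_conjg_self: "x * conjg x = scaleR ((norm x)\<^sup>2) 1"

instantiation real :: conj_field
begin
definition conjg_real :: "real \<Rightarrow> real" where "conjg_real x = x"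
instance by standard (auto simp: conjg_real_def power2_eq_square)
end

instantiation complex :: conj_field
begin
definition conjg_complex :: "complex \<Rightarrow> complex" where "conjg_complex = cnj"
instance by standard (auto simp: conjg_complex_def complex_mult_cnj scaleR_conv_of_real cmod_power2)
end

section \<open>Matrices and singular values\<close>

text \<open>
  A matrix with \<open>n\<close> rows and \<open>m\<close> columns over the field \<open>'k\<close> has type \<open>'k^'m^'n\<close>. The library's
  norm on this type is the Frobenius norm, and its inner product is the real part of
  \<open>frob\<close>; see \<open>inner_eq_frob\<close> below.
\<close>

definition ctranspose :: "'k::conj_field^'m^'n \<Rightarrow> 'k^'n^'m"
  where "ctranspose A = (\<chi> j i. conjg (A $ i $ j))"

definition frob :: "'k::conj_field^'m^'n \<Rightarrow> 'k^'m^'n \<Rightarrow> 'k"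
  where "frob M N = trace (ctranspose N ** M)"

definition cscale :: "'k::conj_field \<Rightarrow> 'k^'m^'n \<Rightarrow> 'k^'m^'n"
  where "cscale c A = (\<chi> i j. c * A $ i $ j)"

text \<open>
  The square roots of the eigenvalues of \<open>A A\<^sup>*\<close>, in decreasing order, repeated according to
  multiplicity.
\<close>

definition singular_values :: "'k::conj_field^'m^'n \<Rightarrow> real list"
  where "singular_values A = (THE xs.
    length xs = CARD('n) \<and> sorted_wrt (\<ge>) xs \<and> (\<forall>s\<in>set xs. 0 \<le> s) \<and>
    (\<forall>s\<ge>0. count_list xs s =
       vec.dim {x. (A ** ctranspose A) *v x = of_real (s\<^sup>2) *s x}))"

definition singular_value :: "nat \<Rightarrow> 'k::conj_field^'m^'n \<Rightarrow> real"
  where "singular_value k A = singular_values A ! (k - 1)"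

text \<open>For \<open>n = 1\<close> the only singular value is simple, so there is nothing to require.\<close>

definition GL_simple :: "('k::conj_field^'m^'n) set"
  where "GL_simple = {A. rank A = CARD('n) \<and>
    (2 \<le> CARD('n) \<longrightarrow> singular_value (CARD('n) - 1) A > singular_value CARD('n) A)}"

section \<open>Riemannian manifolds in coordinates\<close>

text \<open>
  A chart of a Riemannian manifold is given by its inverse, a parametrization \<open>rc_param\<close> of a
  part of the manifold by a relatively open subset \<open>rc_dom\<close> of a linear subspace \<open>rc_model\<close> of a
  Euclidean space, together with the expression \<open>rc_metric x u v\<close> of the metric in this chart,
  for \<open>x\<close> in the domain and \<open>u\<close>, \<open>v\<close> in the model space. Using subspaces rather than whole types
  as model spaces allows every dimension, including \<open>0\<close>.
\<close>

record ('p, 'e) rchart =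
  rc_model :: "'e set"
  rc_dom :: "'e set"
  rc_param :: "'e \<Rightarrow> 'p"
  rc_metric :: "'e \<Rightarrow> 'e \<Rightarrow> 'e \<Rightarrow> real"

text \<open>
  \<open>C\<^sup>k\<close> maps on a relatively open subset \<open>V\<close> of a linear subspace \<open>E\<close>. The derivative within
  \<open>V\<close> is determined on \<open>E\<close> only, whence the restriction on the direction \<open>u\<close>.
\<close>

primrec Ck_on :: "nat \<Rightarrow> 'e::euclidean_space set \<Rightarrow> 'e set \<Rightarrow> ('e \<Rightarrow> 'b::real_normed_vector) \<Rightarrow> bool"
  where
    "Ck_on 0 E V f = continuous_on V f"
  | "Ck_on (Suc k) E V f =
       (\<exists>D. (\<forall>x\<in>V. (f has_derivative D x) (at x within V)) \<and>
            (\<forall>u\<in>E. Ck_on k E V (\<lambda>x. D x u)))"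

definition riemannian_chart :: "('p, 'e::euclidean_space) rchart \<Rightarrow> bool"
  where "riemannian_chart \<xi> \<longleftrightarrow>
    (let E = rc_model \<xi>; V = rc_dom \<xi>; g = rc_metric \<xi> in
      subspace E \<and> openin (top_of_set E) V \<and> inj_on (rc_param \<xi>) V \<and>
      (\<forall>x\<in>V. \<forall>u\<in>E. \<forall>v\<in>E. g x u v = g x v u) \<and>
      (\<forall>x\<in>V. \<forall>u\<in>E. \<forall>v\<in>E. \<forall>w\<in>E. \<forall>a b. g x (a *\<^sub>R u + b *\<^sub>R v) w = a * g x u w + b * g x v w) \<and>
      (\<forall>x\<in>V. \<forall>u\<in>E. u \<noteq> 0 \<longrightarrow> g x u u > 0) \<and>
      (\<forall>u\<in>E. \<forall>v\<in>E. \<forall>k. Ck_on k E V (\<lambda>x. g x u v)))"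

definition riemannian_transition ::
    "('p, 'e::euclidean_space) rchart \<Rightarrow> ('p, 'e) rchart \<Rightarrow> bool"
  where "riemannian_transition \<xi> \<xi>' \<longleftrightarrow>
    (let W = {x \<in> rc_dom \<xi>. rc_param \<xi> x \<in> rc_param \<xi>' ` rc_dom \<xi>'};
         \<tau> = (\<lambda>x. inv_into (rc_dom \<xi>') (rc_param \<xi>') (rc_param \<xi> x)) in
      openin (top_of_set (rc_model \<xi>)) W \<and> (\<forall>k. Ck_on k (rc_model \<xi>) W \<tau>) \<and>
      (\<forall>x\<in>W. \<exists>D. (\<tau> has_derivative D) (at x within W) \<and>
        (\<forall>u\<in>rc_model \<xi>. \<forall>v\<in>rc_model \<xi>.
          rc_metric \<xi> x u v = rc_metric \<xi>' (\<tau> x) (D u) (D v))))"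

definition riemannian_atlas :: "('p, 'e::euclidean_space) rchart set \<Rightarrow> bool"
  where "riemannian_atlas \<A> \<longleftrightarrow>
    (\<forall>\<xi>\<in>\<A>. riemannian_chart \<xi>) \<and> (\<forall>\<xi>\<in>\<A>. \<forall>\<xi>'\<in>\<A>. riemannian_transition \<xi> \<xi>')"

definition restrict_chart :: "'p set \<Rightarrow> ('p, 'e) rchart \<Rightarrow> ('p, 'e) rchart"
  where "restrict_chart U \<xi> = \<xi>\<lparr>rc_dom := {x \<in> rc_dom \<xi>. rc_param \<xi> x \<in> U}\<rparr>"

definition conformal_chart :: "('p \<Rightarrow> real) \<Rightarrow> ('p, 'e) rchart \<Rightarrow> ('p, 'e) rchart"
  where "conformal_chart \<alpha> \<xi> =
    \<xi>\<lparr>rc_metric := (\<lambda>x u v. \<alpha> (rc_param \<xi> x) * rc_metric \<xi> x u v)\<rparr>"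

text \<open>
  Christoffel symbols of the first kind: the Koszul formula for constant vector fields \<open>u\<close>, \<open>v\<close>,
  \<open>w\<close> in the chart, i.e. the inner product of the Levi-Civita derivative of \<open>v\<close> along \<open>u\<close>
  with \<open>w\<close>.
\<close>

definition metric_deriv ::
    "('p, 'e::real_normed_vector) rchart \<Rightarrow> 'e \<Rightarrow> 'e \<Rightarrow> 'e \<Rightarrow> 'e \<Rightarrow> real"
  where "metric_deriv \<xi> x u v w = deriv (\<lambda>t. rc_metric \<xi> (x + t *\<^sub>R u) v w) 0"

definition christoffel ::
    "('p, 'e::real_normed_vector) rchart \<Rightarrow> 'e \<Rightarrow> 'e \<Rightarrow> 'e \<Rightarrow> 'e \<Rightarrow> real"
  where "christoffel \<xi> x u v w =
    (metric_deriv \<xi> x u v w + metric_deriv \<xi> x v u w - metric_deriv \<xi> x w u v) / 2"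

text \<open>
  The equation says that the covariant derivative of the velocity along the curve, paired with
  an arbitrary tangent vector \<open>w\<close>, vanishes.
\<close>

definition geodesic_in_chart ::
    "('p, 'e::real_normed_vector) rchart \<Rightarrow> real set \<Rightarrow> (real \<Rightarrow> 'e) \<Rightarrow> bool"
  where "geodesic_in_chart \<xi> J c \<longleftrightarrow>
    (\<exists>c' c''. \<forall>t\<in>J. c t \<in> rc_dom \<xi> \<and>
      (c has_vector_derivative c' t) (at t) \<and>
      (c' has_vector_derivative c'' t) (at t) \<and>
      (\<forall>w\<in>rc_model \<xi>. rc_metric \<xi> (c t) (c'' t) w + christoffel \<xi> (c t) (c' t) (c' t) w = 0))"

definition geodesic_on ::
    "('p, 'e::real_normed_vector) rchart set \<Rightarrow> real set \<Rightarrow> (real \<Rightarrow> 'p) \<Rightarrow> bool"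
  where "geodesic_on \<A> I \<gamma> \<longleftrightarrow> open I \<and> is_interval I \<and>
    (\<forall>t\<in>I. \<exists>\<xi>\<in>\<A>. \<exists>J c. open J \<and> t \<in> J \<and> J \<subseteq> I \<and>
       geodesic_in_chart \<xi> J c \<and> (\<forall>s\<in>J. \<gamma> s = rc_param \<xi> (c s)))"

definition self_convex :: "('p, 'e::euclidean_space) rchart set \<Rightarrow> ('p \<Rightarrow> real) \<Rightarrow> bool"
  where "self_convex \<A> \<alpha> \<longleftrightarrow>
    (\<forall>\<xi>\<in>\<A>. Ck_on 2 (rc_model \<xi>) (rc_dom \<xi>) (\<lambda>x. \<alpha> (rc_param \<xi> x))) \<and>
    (\<forall>\<xi>\<in>\<A>. \<forall>x\<in>rc_dom \<xi>. \<alpha> (rc_param \<xi> x) > 0) \<and>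
    (\<forall>I \<gamma>. geodesic_on (conformal_chart \<alpha> ` \<A>) I \<gamma> \<longrightarrow> convex_on I (\<lambda>t. ln (\<alpha> (\<gamma> t))))"

section \<open>Projective space\<close>

text \<open>A point of the projective space is represented by the set of its nonzero representatives.\<close>

definition proj :: "'k::conj_field^'m^'n \<Rightarrow> ('k^'m^'n) set"
  where "proj B = {cscale c B | c. c \<noteq> 0}"

text \<open>
  The affine chart centred at a unit matrix \<open>A\<close> sends the line of \<open>B\<close>, where \<open>frob B A \<noteq> 0\<close>, to
  the \<open>X\<close> orthogonal to \<open>A\<close> such that \<open>A + X\<close> lies on this line. As a map of \<open>B\<close> it is the
  canonical projection followed by the chart.
\<close>

definition proj_coord :: "'k::conj_field^'m^'n \<Rightarrow> 'k^'m^'n \<Rightarrow> 'k^'m^'n"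
  where "proj_coord A B = cscale (inverse (frob B A)) B - A"

definition dproj :: "'k::conj_field^'m^'n \<Rightarrow> 'k^'m^'n \<Rightarrow> 'k^'m^'n \<Rightarrow> 'k^'m^'n"
  where "dproj A B = frechet_derivative (proj_coord A) (at B)"

text \<open>
  The tangent space of the unit sphere at \<open>B\<close> consists of the \<open>w\<close> with \<open>w \<bullet> B = 0\<close>; the
  horizontal space at \<open>B\<close> is the orthogonal complement, within this tangent space, of the kernel
  of the differential of the projection. The metric of the projective space is the one that
  makes the differential of the projection from the sphere an isometry on horizontal spaces. By
  \<open>proj_riemannian_submersion\<close> below it does not matter that a particular unit
  representative is used here.
\<close>

definition horizontal :: "'k::conj_field^'m^'n \<Rightarrow> 'k^'m^'n \<Rightarrow> ('k^'m^'n) set"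
  where "horizontal A B = {w. w \<bullet> B = 0 \<and> (\<forall>v. v \<bullet> B = 0 \<and> dproj A B v = 0 \<longrightarrow> w \<bullet> v = 0)}"

definition horizontal_lift :: "'k::conj_field^'m^'n \<Rightarrow> 'k^'m^'n \<Rightarrow> 'k^'m^'n \<Rightarrow> 'k^'m^'n"
  where "horizontal_lift A B u = (THE w. w \<in> horizontal A B \<and> dproj A B w = u)"

definition proj_metric ::
    "'k::conj_field^'m^'n \<Rightarrow> 'k^'m^'n \<Rightarrow> 'k^'m^'n \<Rightarrow> 'k^'m^'n \<Rightarrow> real"
  where "proj_metric A X u v =
    (let B = sgn (A + X) in horizontal_lift A B u \<bullet> horizontal_lift A B v)"

definition proj_chart :: "'k::conj_field^'m^'n \<Rightarrow> (('k^'m^'n) set, 'k^'m^'n) rchart"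
  where "proj_chart A =
    \<lparr> rc_model = {X. frob X A = 0}, rc_dom = {X. frob X A = 0},
      rc_param = (\<lambda>X. proj (A + X)), rc_metric = proj_metric A \<rparr>"

definition proj_atlas :: "(('k::conj_field^'m^'n) set, 'k^'m^'n) rchart set"
  where "proj_atlas = proj_chart ` sphere 0 1"

definition PGL_atlas :: "(('k::conj_field^'m^'n) set, 'k^'m^'n) rchart set"
  where "PGL_atlas = restrict_chart (proj ` GL_simple) ` proj_atlas"

text \<open>The function on lines induced by a scaling-invariant function of matrices.\<close>

definition alpha2 :: "('k::conj_field^'m^'n) set \<Rightarrow> real"
  where "alpha2 L = the_elem ((\<lambda>A. (norm A)\<^sup>2 * inverse ((singular_value CARD('n) A)\<^sup>2)) ` L)"

section \<open>Verification of the projective structure\<close>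

subsection \<open>Conjugation, Hermitian product and scaling\<close>

lemma conjg_0 [simp]: "conjg (0::'k::conj_field) = 0"
  using conjg_add[of "0::'k" 0] by simp

lemma conjg_minus: "conjg (- x :: 'k::conj_field) = - conjg x"
  using conjg_add[of x "- x"] by (simp add: eq_neg_iff_add_eq_0 add.commute)

lemma mult_conjg_self': "x * conjg x = (of_real ((norm x)\<^sup>2) :: 'k::conj_field)"
  by (simp add: mult_conjg_self of_real_def)

lemma conjg_of_real [simp]: "conjg (of_real r :: 'k::conj_field) = of_real r"
proof (cases "r = 0")
  case False
  have "of_real r * conjg (of_real r :: 'k) = of_real r * of_real r"
    using mult_conjg_self'[of "of_real r :: 'k"] by (simp add: power2_eq_square flip: of_real_mult)
  then show ?thesis using False by (metis mult_left_cancel of_real_eq_0_iff)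
qed simp

lemma conjg_scaleR: "conjg (r *\<^sub>R x) = r *\<^sub>R conjg (x :: 'k::conj_field)"
  by (simp add: scaleR_conv_of_real conjg_mult)

lemma conjg_sum: "conjg (sum f S) = (\<Sum>x\<in>S. conjg (f x :: 'k::conj_field))"
  by (induction S rule: infinite_finite_induct) (auto simp: conjg_add)

lemma plus_conjg_aux: "x * conjg y + y * conjg x = (of_real (2 * (x \<bullet> y)) :: 'k::conj_field)"
proof -
  have "(x + y) * conjg (x + y) = of_real ((norm (x + y))\<^sup>2)"
    by (rule mult_conjg_self')
  also have "(norm (x + y))\<^sup>2 = (norm x)\<^sup>2 + (norm y)\<^sup>2 + 2 * (x \<bullet> y)"
    by (simp add: power2_norm_eq_inner inner_simps inner_commute)
  finally show ?thesis
    using mult_conjg_self'[of x] mult_conjg_self'[of y]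
    by (simp add: conjg_add algebra_simps)
qed

lemma conjg_1 [simp]: "conjg (1 :: 'k::conj_field) = 1"
  using conjg_of_real[of 1] by simp

lemma inner_conjg: "x \<bullet> y = (x * conjg y) \<bullet> (1 :: 'k::conj_field)"
proof -
  have "(of_real (2 * ((x * conjg y) \<bullet> 1)) :: 'k) = of_real (2 * (x \<bullet> y))"
    using plus_conjg_aux[of "x * conjg y" 1] plus_conjg_aux[of x y]
    by (simp add: conjg_mult mult.commute)
  then show ?thesis
    by (simp only: of_real_eq_iff)
qed

lemma frob_alt: "frob M N = (\<Sum>i\<in>UNIV. \<Sum>j\<in>UNIV. M $ i $ j * conjg (N $ i $ j))"
proof -
  have "frob M N = (\<Sum>j\<in>UNIV. \<Sum>i\<in>UNIV. M $ i $ j * conjg (N $ i $ j))"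
    by (simp add: frob_def trace_def ctranspose_def matrix_matrix_mult_def mult.commute)
  also have "\<dots> = (\<Sum>i\<in>UNIV. \<Sum>j\<in>UNIV. M $ i $ j * conjg (N $ i $ j))"
    by (rule sum.swap)
  finally show ?thesis .
qed

lemma inner_eq_frob: "M \<bullet> N = frob M N \<bullet> 1"
  by (simp add: inner_vec_def frob_alt inner_sum_left)
     (intro sum.cong refl, rule inner_conjg)

lemma frob_add_left: "frob (M + M') N = frob M N + frob M' N"
  by (simp add: frob_alt algebra_simps sum.distrib)

lemma frob_add_right: "frob M (N + N') = frob M N + frob M N'"
  by (simp add: frob_alt algebra_simps sum.distrib conjg_add)

lemma frob_cscale_left: "frob (cscale c M) N = c * frob M N"
  by (simp add: frob_alt cscale_def sum_distrib_left mult.assoc)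

lemma frob_cscale_right: "frob M (cscale c N) = conjg c * frob M N"
  by (simp add: frob_alt cscale_def sum_distrib_left conjg_mult algebra_simps)

lemma cscale_of_real: "cscale (of_real r) (M :: 'k::conj_field^'m^'n) = r *\<^sub>R M"
  by (simp add: cscale_def vec_eq_iff scaleR_conv_of_real[where 'a='k])

lemma frob_scaleR_left: "frob (r *\<^sub>R M) (N :: 'k::conj_field^'m^'n) = r *\<^sub>R frob M N"
  by (simp add: frob_cscale_left scaleR_conv_of_real[where 'a='k] flip: cscale_of_real)

lemma frob_scaleR_right: "frob M (r *\<^sub>R (N :: 'k::conj_field^'m^'n)) = r *\<^sub>R frob M N"
  by (simp add: frob_cscale_right scaleR_conv_of_real[where 'a='k] flip: cscale_of_real)

lemma frob_minus_left: "frob (- M) N = - frob M N"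
  using frob_scaleR_left[of "-1" M N] by simp

lemma frob_minus_right: "frob M (- N) = - frob M N"
  using frob_scaleR_right[of M "-1" N] by simp

lemma frob_diff_left: "frob (M - M') N = frob M N - frob M' N"
  using frob_add_left[of M "- M'" N] by (simp add: frob_minus_left)

lemma frob_diff_right: "frob M (N - N') = frob M N - frob M N'"
  using frob_add_right[of M N "- N'"] by (simp add: frob_minus_right)

lemma frob_conjg: "conjg (frob M N) = frob N M"
  by (simp add: frob_alt conjg_sum conjg_mult mult.commute)

lemma frob_self: "frob M M = of_real ((norm M)\<^sup>2)"
proof -
  have "frob M M = of_real (\<Sum>i\<in>UNIV. \<Sum>j\<in>UNIV. (norm (M $ i $ j))\<^sup>2)"
    by (simp add: frob_alt mult_conjg_self')
  moreover have "(\<Sum>i\<in>UNIV. \<Sum>j\<in>UNIV. (norm (M $ i $ j))\<^sup>2) = (norm M)\<^sup>2"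
    by (simp add: power2_norm_eq_inner inner_vec_def)
  ultimately show ?thesis by simp
qed

lemma cscale_add_left: "cscale (c + d) M = cscale c M + cscale d M"
  by (simp add: cscale_def vec_eq_iff algebra_simps)

lemma cscale_add_right: "cscale c (M + N) = cscale c M + cscale c N"
  by (simp add: cscale_def vec_eq_iff algebra_simps)

lemma cscale_minus_left: "cscale (- c) M = - cscale c M"
  by (simp add: cscale_def vec_eq_iff)

lemma cscale_diff_right: "cscale c (M - N) = cscale c M - cscale c N"
  by (simp add: cscale_def vec_eq_iff algebra_simps)

lemma cscale_cscale: "cscale c (cscale d M) = cscale (c * d) M"
  by (simp add: cscale_def vec_eq_iff mult.assoc)

lemma cscale_1 [simp]: "cscale 1 M = M"
  by (simp add: cscale_def vec_eq_iff)

lemma cscale_0 [simp]: "cscale c 0 = 0" "cscale 0 M = 0"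
  by (simp_all add: cscale_def vec_eq_iff)

lemma norm_cscale: "norm (cscale c M) = norm c * norm M"
proof -
  have "of_real ((norm (cscale c M))\<^sup>2) = (of_real ((norm c * norm M)\<^sup>2) :: 'a)"
    unfolding frob_self[symmetric] power_mult_distrib of_real_mult mult_conjg_self'[symmetric]
    by (simp add: frob_cscale_left frob_cscale_right)
  then show ?thesis
    by (simp only: of_real_eq_iff) (simp add: power2_eq_iff_nonneg)
qed

lemma bilinear_frob: "bounded_bilinear (frob :: 'k::conj_field^'m^'n \<Rightarrow> _)"
  unfolding bilinear_conv_bounded_bilinear[symmetric] bilinear_def
  by (auto intro!: linearI simp: frob_add_left frob_add_right frob_scaleR_left frob_scaleR_right)

lemma bilinear_cscale: "bounded_bilinear (cscale :: 'k::conj_field \<Rightarrow> 'k^'m^'n \<Rightarrow> _)"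
  unfolding bilinear_conv_bounded_bilinear[symmetric] bilinear_def
  by (auto intro!: linearI simp: cscale_add_left cscale_add_right)
     (simp_all add: cscale_def vec_eq_iff)

lemma frob_self_eq_0_iff: "frob M M = 0 \<longleftrightarrow> M = 0"
  by (simp add: frob_self)

lemma inner_eq_0_imp_frob:
  assumes "\<And>c. w \<bullet> cscale c B = 0"
  shows "frob w B = 0"
proof -
  have "(frob w B * conjg (frob w B)) \<bullet> 1 = 0"
    using assms[of "frob w B"] by (simp add: inner_eq_frob frob_cscale_right mult.commute)
  then show ?thesis
    using inner_conjg[of "frob w B" "frob w B"] by simp
qed

subsection \<open>The metric\<close>

lemma has_derivative_proj_coord:
  assumes "frob B A \<noteq> 0"
  shows "(proj_coord A has_derivative (\<lambda>v.
    cscale (inverse (frob B A)) v - cscale (frob v A / (frob B A)\<^sup>2) B)) (at B within S)"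
proof -
  have bl: "bounded_linear (\<lambda>B. frob B A)"
    by (rule bounded_bilinear.bounded_linear_left[OF bilinear_frob])
  have "((\<lambda>B. cscale (inverse (frob B A)) B) has_derivative
     (\<lambda>v. cscale (inverse (frob B A)) v + cscale (- (inverse (frob B A) * frob v A * inverse (frob B A))) B)) (at B within S)"
    by (rule bounded_bilinear.FDERIV[OF bilinear_cscale])
       (use assms in \<open>auto intro!: Deriv.has_derivative_inverse bounded_linear.has_derivative[OF bl]\<close>)
  then have "((\<lambda>B. cscale (inverse (frob B A)) B - A) has_derivative
     (\<lambda>v. cscale (inverse (frob B A)) v + cscale (- (inverse (frob B A) * frob v A * inverse (frob B A))) B - 0)) (at B within S)"
    by (intro has_derivative_diff has_derivative_const)
  then show ?thesis
    by (simp add: proj_coord_def[abs_def] cscale_minus_left divide_inverse power2_eq_square algebra_simps)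
qed

lemma dproj_eq:
  assumes "frob B A \<noteq> 0"
  shows "dproj A B v = cscale (inverse (frob B A)) v - cscale (frob v A / (frob B A)\<^sup>2) B"
  using frechet_derivative_at[OF has_derivative_proj_coord[OF assms, of UNIV], symmetric]
  unfolding dproj_def by metis

lemma horizontal_eq:
  assumes B: "norm B = 1" and f: "frob B A \<noteq> 0"
  shows "horizontal A B = {w. frob w B = 0}"
proof (intro equalityI subsetI CollectI)
  fix w assume w: "w \<in> horizontal A B"
  show "frob w B = 0"
  proof (rule inner_eq_0_imp_frob)
    fix c
    define r where "r = cscale c B \<bullet> B"
    define v where "v = cscale c B - r *\<^sub>R B"
    have "v \<bullet> B = 0"
      using B by (simp add: v_def r_def inner_diff_left dot_square_norm)
    moreover have v: "v = cscale (c - of_real r) B"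
      by (simp add: v_def cscale_add_left[of c "- of_real r", simplified] cscale_minus_left cscale_of_real)
    then have "dproj A B v = 0"
    proof -
      have "(c - of_real r) * frob B A / (frob B A)\<^sup>2 = inverse (frob B A) * (c - of_real r)"
        using f by (simp add: power2_eq_square divide_inverse)
      then show ?thesis
        by (simp only: v dproj_eq[OF f] frob_cscale_left cscale_cscale) simp
    qed
    ultimately have "w \<bullet> v = 0" "w \<bullet> B = 0"
      using w by (auto simp: horizontal_def)
    then show "w \<bullet> cscale c B = 0"
      by (simp add: v_def inner_diff_right)
  qed
next
  fix w assume "w \<in> {w. frob w B = 0}"
  then have w: "frob w B = 0" by simp
  have "w \<bullet> v = 0" if "dproj A B v = 0" for v
  proof -
    have "cscale (frob B A) (cscale (inverse (frob B A)) v) = cscale (frob B A) (cscale (frob v A / (frob B A)\<^sup>2) B)"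
      using that f by (simp add: dproj_eq)
    then have "v = cscale (frob v A / frob B A) B"
      using f by (simp add: cscale_cscale power2_eq_square)
    then show ?thesis
      using w by (metis frob_cscale_right inner_eq_frob inner_zero_left mult_zero_right)
  qed
  then show "w \<in> horizontal A B"
    using w by (auto simp: horizontal_def inner_eq_frob)
qed

text \<open>
  The orthogonal projection onto the horizontal space at an arbitrary representative \<open>B\<close>.
\<close>

definition hor :: "'k::conj_field^'m^'n \<Rightarrow> 'k^'m^'n \<Rightarrow> 'k^'m^'n"
  where "hor B u = u - cscale (frob u B / of_real ((norm B)\<^sup>2)) B"

lemma hor_cscale:
  assumes c: "c \<noteq> 0"
  shows "hor (cscale c B) u = hor B u"
proof -
  have "(c * conjg c) * (frob u B / of_real ((norm B)\<^sup>2)) / of_real ((norm c)\<^sup>2) =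
      frob u B / of_real ((norm B)\<^sup>2)"
    using c by (simp add: mult_conjg_self')
  then show ?thesis
    by (simp add: hor_def norm_cscale frob_cscale_right cscale_cscale power_mult_distrib
      algebra_simps)
qed

lemma horizontal_lift_eq:
  assumes B: "norm B = 1" and f: "frob B A \<noteq> 0" and u: "frob u A = 0"
  shows "horizontal_lift A B u = cscale (frob B A) (hor B u)"
  unfolding horizontal_lift_def horizontal_eq[OF B f]
proof (rule the_equality, safe)
  have *: "frob B B = 1" using B by (simp add: frob_self)
  show "frob (cscale (frob B A) (hor B u)) B = 0"
    using B * by (simp add: frob_cscale_left hor_def frob_diff_left)
  show "dproj A B (cscale (frob B A) (hor B u)) = u"
    using B f u
    by (simp add: dproj_eq cscale_cscale frob_cscale_left frob_diff_left hor_def field_simps power2_eq_square cscale_minus_left)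
next
  fix w assume w: "frob w B = 0" and u: "u = dproj A B w"
  have *: "frob B B = 1" using B by (simp add: frob_self)
  have "frob u B = - (frob w A / (frob B A)\<^sup>2)"
    using w * f by (simp add: u dproj_eq frob_diff_left frob_cscale_left)
  then have "hor B u = cscale (inverse (frob B A)) w"
    using B by (simp add: hor_def cscale_minus_left) (simp add: u dproj_eq f)
  then show "w = cscale (frob B A) (hor B (dproj A B w))"
    using f u by (simp add: cscale_cscale)
qed

lemma inner_cscale_cscale: "cscale c M \<bullet> cscale c N = (norm c)\<^sup>2 * (M \<bullet> N)"
proof -
  have "cscale c M \<bullet> cscale c N = ((c * conjg c) * frob M N) \<bullet> 1"
    by (simp add: inner_eq_frob frob_cscale_left frob_cscale_right ac_simps)
  also have "\<dots> = (of_real ((norm c)\<^sup>2) * frob M N) \<bullet> 1"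
    by (simp only: mult_conjg_self')
  finally show ?thesis
    by (simp add: inner_eq_frob flip: scaleR_conv_of_real of_real_power)
qed

lemma frob_zero_left [simp]: "frob 0 M = 0"
  using frob_scaleR_left[of 0 0 M] by simp

lemma proj_metric_eq:
  assumes A: "norm A = 1" and X: "frob X A = 0" and u: "frob u A = 0" and v: "frob v A = 0"
  shows "proj_metric A X u v = (hor (A + X) u \<bullet> hor (A + X) v) / (norm (A + X))\<^sup>2"
proof -
  have f1: "frob (A + X) A = 1"
    using A X by (simp add: frob_add_left frob_self)
  then have nz: "A + X \<noteq> 0"
    by auto
  define B where "B = sgn (A + X)"
  define r where "r = norm (A + X)"
  have r: "r > 0" using nz by (simp add: r_def)
  have Bs: "B = cscale (of_real (inverse r)) (A + X)"
    by (simp only: cscale_of_real) (simp add: B_def sgn_div_norm r_def)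
  have B: "norm B = 1" using nz by (simp add: B_def norm_sgn)
  have f: "frob B A = of_real (inverse r)"
    by (simp add: Bs frob_cscale_left f1)
  have h: "hor B = hor (A + X)"
    using r by (simp add: Bs hor_cscale fun_eq_iff)
  have f0: "frob B A \<noteq> 0" using f r by simp
  show ?thesis
    unfolding proj_metric_def Let_def B_def[symmetric]
    using horizontal_lift_eq[OF B f0 u] horizontal_lift_eq[OF B f0 v] r
    by (simp add: inner_cscale_cscale h f r_def[symmetric] norm_divide power_divide field_simps)
qed

text \<open>
  The projection is a Riemannian submersion at every point \<open>B\<close> of the unit sphere.
\<close>

lemma proj_riemannian_submersion:
  assumes A: "norm A = 1" and B: "norm B = 1" and f: "frob B A \<noteq> 0"
    and w: "w \<in> horizontal A B" and w': "w' \<in> horizontal A B"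
  shows "proj_metric A (proj_coord A B) (dproj A B w) (dproj A B w') = w \<bullet> w'"
proof -
  define c where "c = inverse (frob B A)"
  have c: "c \<noteq> 0" using f by (simp add: c_def)
  have BB: "frob B B = 1" using B by (simp add: frob_self)
  have AA: "frob A A = 1" using A by (simp add: frob_self)
  have X: "A + proj_coord A B = cscale c B"
    by (simp add: proj_coord_def c_def)
  have 1: "frob (proj_coord A B) A = 0"
    using f AA by (simp add: proj_coord_def frob_diff_left frob_cscale_left)
  have 2: "frob (dproj A B x) A = 0" for x
    using f by (simp add: dproj_eq frob_diff_left frob_cscale_left power2_eq_square field_simps)
  have 3: "hor B (dproj A B x) = cscale c x" if "x \<in> horizontal A B" for x
  proof -
    have x: "frob x B = 0" using that horizontal_eq[OF B f] by auto
    show ?thesis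
      using B BB f x by (simp add: hor_def dproj_eq frob_diff_left frob_cscale_left c_def cscale_minus_left)
  qed
  have "proj_metric A (proj_coord A B) (dproj A B w) (dproj A B w') =
      (cscale c w \<bullet> cscale c w') / (norm (cscale c B))\<^sup>2"
    by (subst proj_metric_eq[OF A 1 2 2]) (simp only: X hor_cscale[OF c] 3[OF w] 3[OF w'])
  then show ?thesis
    using c B by (simp add: inner_cscale_cscale norm_cscale)
qed


subsection \<open>The charts form a Riemannian atlas\<close>

lemma Ck_on_cong:
  assumes "\<And>x. x \<in> V \<Longrightarrow> f x = g x"
  shows "Ck_on k E V f \<longleftrightarrow> Ck_on k E V g"
proof -
  have "(f has_derivative D) (at x within V) \<longleftrightarrow> (g has_derivative D) (at x within V)"
    if "x \<in> V" for x D
    using has_derivative_transform[OF that, of f g] has_derivative_transform[OF that, of g f] assms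
    by metis
  then show ?thesis
    using assms by (cases k) (simp_all cong: continuous_on_cong)
qed

lemma Ck_on_lower: "Ck_on (Suc k) E V f \<Longrightarrow> Ck_on k E V f"
proof (induction k arbitrary: f)
  case 0
  then show ?case by (auto intro: has_derivative_continuous_on)
next
  case (Suc k)
  from Suc.prems obtain D where
    D: "\<forall>x\<in>V. (f has_derivative D x) (at x within V)" "\<forall>u\<in>E. Ck_on (Suc k) E V (\<lambda>x. D x u)"
    unfolding Ck_on.simps(2)[of "Suc k"] by blast
  then show ?case using Suc.IH by auto
qed

lemma Ck_on_const: "Ck_on k E V (\<lambda>x. c)"
  by (induction k arbitrary: c) (auto intro!: exI[of _ "\<lambda>x u. 0"])

lemma Ck_on_ident: "Ck_on k E V (\<lambda>x. x)"
  by (cases k) (auto intro!: exI[of _ "\<lambda>x u. u"] Ck_on_const)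

lemma Ck_on_add:
  "Ck_on k E V f \<Longrightarrow> Ck_on k E V g \<Longrightarrow> Ck_on k E V (\<lambda>x. f x + g x)"
proof (induction k arbitrary: f g)
  case 0
  then show ?case by (auto intro: continuous_on_add)
next
  case (Suc k)
  from Suc.prems obtain D D' where
    "\<forall>x\<in>V. (f has_derivative D x) (at x within V)" "\<forall>u\<in>E. Ck_on k E V (\<lambda>x. D x u)"
    "\<forall>x\<in>V. (g has_derivative D' x) (at x within V)" "\<forall>u\<in>E. Ck_on k E V (\<lambda>x. D' x u)"
    by auto
  then show ?case
    by (auto intro!: exI[of _ "\<lambda>x u. D x u + D' x u"] has_derivative_add Suc.IH)
qed

lemma Ck_on_bilinear:
  assumes "bounded_bilinear h"
  shows "Ck_on k E V f \<Longrightarrow> Ck_on k E V g \<Longrightarrow> Ck_on k E V (\<lambda>x. h (f x) (g x))"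
proof (induction k arbitrary: f g)
  case 0
  then show ?case by (auto intro: bounded_bilinear.continuous_on[OF assms])
next
  case (Suc k)
  from Suc.prems obtain D D' where
    D: "\<forall>x\<in>V. (f has_derivative D x) (at x within V)" "\<forall>u\<in>E. Ck_on k E V (\<lambda>x. D x u)"
    "\<forall>x\<in>V. (g has_derivative D' x) (at x within V)" "\<forall>u\<in>E. Ck_on k E V (\<lambda>x. D' x u)"
    by auto
  have "Ck_on k E V f" "Ck_on k E V g"
    using Suc.prems Ck_on_lower by blast+
  with D show ?case
    by (auto intro!: exI[of _ "\<lambda>x u. h (f x) (D' x u) + h (D x u) (g x)"] Ck_on_add Suc.IH
        bounded_bilinear.FDERIV[OF assms])
qed

lemma Ck_on_inverse:
  fixes f :: "_ \<Rightarrow> 'a::real_normed_field"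
  assumes "\<And>x. x \<in> V \<Longrightarrow> f x \<noteq> 0"
  shows "Ck_on k E V f \<Longrightarrow> Ck_on k E V (\<lambda>x. inverse (f x))"
proof (induction k)
  case 0
  then show ?case using assms by (auto intro: continuous_on_inverse)
next
  case (Suc k)
  from Suc.prems obtain D where
    D: "\<forall>x\<in>V. (f has_derivative D x) (at x within V)" "\<forall>u\<in>E. Ck_on k E V (\<lambda>x. D x u)"
    by auto
  have inv: "Ck_on k E V (\<lambda>x. inverse (f x))"
    using Suc Ck_on_lower by blast
  have "Ck_on k E V (\<lambda>x. (-1) * (inverse (f x) * D x u * inverse (f x)))" if "u \<in> E" for u
    using D that inv by (intro Ck_on_bilinear[OF bounded_bilinear_mult] Ck_on_const) auto
  then have "Ck_on k E V (\<lambda>x. - (inverse (f x) * D x u * inverse (f x)))" if "u \<in> E" for u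
    using that by simp
  then show ?case using D assms
    by (auto intro!: exI[of _ "\<lambda>x u. - (inverse (f x) * D x u * inverse (f x))"]
        Deriv.has_derivative_inverse)
qed

lemma Ck_on_diff_const: "Ck_on k E V f \<Longrightarrow> Ck_on k E V (\<lambda>x. f x - c)"
  using Ck_on_add[OF _ Ck_on_const[of k E V "- c"], of f] by simp

lemma subspace_proj_model: "subspace {X. frob X A = 0}"
  by (auto simp: subspace_def frob_add_left frob_scaleR_left)

lemma proj_eq_iff: "proj B = proj B' \<longleftrightarrow> (\<exists>c. c \<noteq> 0 \<and> B = cscale c B')"
proof
  assume "proj B = proj B'"
  moreover have "B \<in> proj B"
    unfolding proj_def by (auto intro!: exI[of _ 1])
  ultimately show "\<exists>c. c \<noteq> 0 \<and> B = cscale c B'"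
    by (auto simp: proj_def)
next
  assume "\<exists>c. c \<noteq> 0 \<and> B = cscale c B'"
  then obtain c where c: "c \<noteq> 0" "B = cscale c B'" by auto
  have "cscale d B \<in> proj B'" "cscale d B' \<in> proj B" if "d \<noteq> 0" for d
    using that c
    by (auto simp: proj_def cscale_cscale intro: exI[of _ "d * c"] exI[of _ "d / c"])
  then show "proj B = proj B'"
    unfolding proj_def by blast
qed

lemma proj_coord_unique:
  assumes A: "norm A = 1" and X: "frob X A = 0" and p: "proj B = proj (A + X)"
  shows "frob B A \<noteq> 0" "X = proj_coord A B"
proof -
  obtain c where c: "c \<noteq> 0" "B = cscale c (A + X)"
    using p proj_eq_iff by blast
  have f: "frob B A = c"
    using A X by (simp add: c frob_cscale_left frob_add_left frob_self)
  then show "frob B A \<noteq> 0" "X = proj_coord A B"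
    using c(1) by (simp_all add: proj_coord_def) (simp add: c(2) cscale_cscale)
qed

lemma proj_coord_props:
  assumes A: "norm A = 1" and f: "frob B A \<noteq> 0"
  shows "frob (proj_coord A B) A = 0" "proj B = proj (A + proj_coord A B)"
  using assms
  by (auto simp: proj_coord_def frob_diff_left frob_cscale_left frob_self proj_eq_iff cscale_cscale
      intro!: exI[of _ "frob B A"])

lemma cscale_scaleR_left: "cscale (r *\<^sub>R c) M = r *\<^sub>R cscale c M"
  by (simp add: cscale_def vec_eq_iff)

lemma hor_linear: "hor B (a *\<^sub>R u + b *\<^sub>R v) = a *\<^sub>R hor B u + b *\<^sub>R hor B v"
  by (simp only: hor_def frob_add_left frob_scaleR_left divide_inverse distrib_right
      mult_scaleR_left cscale_add_left cscale_scaleR_left scaleR_diff_right) simp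

lemma hor_cscale_self: "hor B (cscale c u - cscale d B) = cscale c (hor B u)"
proof (cases "B = 0")
  case False
  then have "(c * frob u B - d * of_real ((norm B)\<^sup>2)) / of_real ((norm B)\<^sup>2) =
      c * (frob u B / of_real ((norm B)\<^sup>2)) + - d"
    by (simp add: diff_divide_distrib)
  then have "hor B (cscale c u - cscale d B) = cscale c u - cscale d B -
      cscale (c * (frob u B / of_real ((norm B)\<^sup>2)) + - d) B"
    by (simp only: hor_def frob_diff_left frob_cscale_left frob_self)
  then show ?thesis
    by (simp only: hor_def cscale_add_left cscale_minus_left cscale_diff_right cscale_cscale) simp
qed (simp add: hor_def)

lemma riemannian_chart_proj:
  assumes A: "norm A = 1"
  shows "riemannian_chart (proj_chart A)"
proof -
  let ?E = "{X. frob X A = 0}"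
  have f1: "frob (A + X) A = 1" if "X \<in> ?E" for X
    using A that by (simp add: frob_add_left frob_self)
  then have nz: "A + X \<noteq> 0" if "X \<in> ?E" for X
    using that by force
  have eq: "proj_metric A X u v = (hor (A + X) u \<bullet> hor (A + X) v) / (norm (A + X))\<^sup>2"
    if "X \<in> ?E" "u \<in> ?E" "v \<in> ?E" for X u v
    using that by (intro proj_metric_eq A) auto
  have "inj_on (\<lambda>X. proj (A + X)) ?E"
    by (rule inj_onI) (metis (mono_tags) A mem_Collect_eq proj_coord_unique(2))
  moreover have "proj_metric A X u v = proj_metric A X v u"
    if "X \<in> ?E" "u \<in> ?E" "v \<in> ?E" for X u v
    using that by (simp add: eq inner_commute)
  moreover have "proj_metric A X (a *\<^sub>R u + b *\<^sub>R v) w =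
      a * proj_metric A X u w + b * proj_metric A X v w"
    if "X \<in> ?E" "u \<in> ?E" "v \<in> ?E" "w \<in> ?E" for X u v w a b
    using that subspace_proj_model[of A]
    by (simp add: eq subspace_add subspace_scale frob_add_left frob_scaleR_left hor_linear
        inner_add_left add_divide_distrib)
  moreover have "proj_metric A X u u > 0" if "X \<in> ?E" "u \<in> ?E" "u \<noteq> 0" for X u
  proof -
    have "hor (A + X) u \<noteq> 0"
    proof
      assume "hor (A + X) u = 0"
      then obtain c where c: "u = cscale c (A + X)"
        by (auto simp: hor_def)
      then have "frob u A = c" using f1[OF that(1)] by (simp add: frob_cscale_left)
      then show False using that c by simp
    qed
    then show ?thesis using that nz[OF that(1)] by (simp add: eq)
  qed
  moreover have "Ck_on k ?E ?E (\<lambda>X. proj_metric A X u v)" if "u \<in> ?E" "v \<in> ?E" for k u v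
  proof -
    have B: "Ck_on k ?E ?E (\<lambda>X. A + X)"
      by (intro Ck_on_add Ck_on_const Ck_on_ident)
    have inv: "Ck_on k ?E ?E (\<lambda>X. inverse (frob (A + X) (A + X)))"
      using nz by (intro Ck_on_inverse Ck_on_bilinear[OF bilinear_frob] B) (simp add: frob_self_eq_0_iff)
    have h: "Ck_on k ?E ?E (\<lambda>X. hor (A + X) z)" for z
    proof -
      have "Ck_on k ?E ?E (\<lambda>X. z + (-1) *\<^sub>R
          cscale (frob z (A + X) * inverse (frob (A + X) (A + X))) (A + X))"
        by (intro Ck_on_add Ck_on_const Ck_on_bilinear[OF bounded_bilinear_scaleR]
            Ck_on_bilinear[OF bilinear_cscale] Ck_on_bilinear[OF bounded_bilinear_mult]
            Ck_on_bilinear[OF bilinear_frob] B inv Ck_on_ident)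
      then show ?thesis
        by (simp add: hor_def frob_self divide_inverse)
    qed
    have "Ck_on k ?E ?E (\<lambda>X. (hor (A + X) u \<bullet> hor (A + X) v) * inverse ((A + X) \<bullet> (A + X)))"
      using nz by (intro Ck_on_bilinear[OF bounded_bilinear_mult]
          Ck_on_bilinear[OF bounded_bilinear_inner] Ck_on_inverse h B) simp
    then show ?thesis
      using that
      by (subst Ck_on_cong[where g =
          "\<lambda>X. (hor (A + X) u \<bullet> hor (A + X) v) * inverse ((A + X) \<bullet> (A + X))"])
         (simp_all add: eq power2_norm_eq_inner divide_inverse)
  qed
  ultimately show ?thesis
    using subspace_proj_model[of A]
    unfolding riemannian_chart_def Let_def proj_chart_def by simp
qed

lemma riemannian_transition_proj:
  assumes A: "norm A = 1" and A': "norm A' = 1"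
  shows "riemannian_transition (proj_chart A) (proj_chart A')"
proof -
  let ?E = "{X. frob X A = 0}" and ?E' = "{X. frob X A' = 0}"
  define W where "W = {X \<in> ?E. proj (A + X) \<in> (\<lambda>X. proj (A' + X)) ` ?E'}"
  define \<tau> where "\<tau> = (\<lambda>X. inv_into ?E' (\<lambda>X. proj (A' + X)) (proj (A + X)))"
  have W: "W = ?E \<inter> {X. frob (A + X) A' \<noteq> 0}"
    unfolding W_def
  proof (intro equalityI subsetI IntI CollectI conjI)
    fix X assume "X \<in> {X \<in> ?E. proj (A + X) \<in> (\<lambda>X. proj (A' + X)) ` ?E'}"
    then show "frob X A = 0" "frob (A + X) A' \<noteq> 0"
      using proj_coord_unique(1)[OF A', of _ "A + X"] by auto
  next
    fix X assume X: "X \<in> ?E \<inter> {X. frob (A + X) A' \<noteq> 0}"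
    then show "frob X A = 0" by simp
    show "proj (A + X) \<in> (\<lambda>X. proj (A' + X)) ` ?E'"
      using X proj_coord_props[OF A', of "A + X"] by blast
  qed
  have inj: "inj_on (\<lambda>X. proj (A' + X)) ?E'"
    by (rule inj_onI) (metis (mono_tags) A' mem_Collect_eq proj_coord_unique(2))
  have \<tau>: "\<tau> X = proj_coord A' (A + X)" if "X \<in> W" for X
  proof -
    have f: "frob (A + X) A' \<noteq> 0" using that by (auto simp: W)
    show ?thesis
      unfolding \<tau>_def
      by (rule inv_into_f_eq[OF inj])
         (use proj_coord_props(1)[OF A' f] in simp, rule proj_coord_props(2)[OF A' f, symmetric])
  qed
  have "continuous_on UNIV (\<lambda>X. frob (A + X) A')"
    by (intro bounded_bilinear.continuous_on[OF bilinear_frob] continuous_intros)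
  then have "open {X. frob (A + X) A' \<noteq> 0}"
    by (intro open_Collect_neq) auto
  then have 1: "openin (top_of_set ?E) W"
    unfolding W by (rule openin_open_Int)
  have B: "Ck_on k ?E W (\<lambda>X. A + X)" for k
    by (intro Ck_on_add Ck_on_const Ck_on_ident)
  have C: "Ck_on k ?E W (\<lambda>X. cscale (inverse (frob (A + X) A')) (A + X) - A')" for k
    by (intro Ck_on_diff_const Ck_on_bilinear[OF bilinear_cscale] Ck_on_inverse
        Ck_on_bilinear[OF bilinear_frob] B Ck_on_const) (auto simp: W)
  have 2: "Ck_on k ?E W \<tau>" for k
    using C[of k] Ck_on_cong[of W \<tau> _ k ?E, OF \<tau>[unfolded proj_coord_def]] by simp
  have 3: "\<exists>D. (\<tau> has_derivative D) (at X within W) \<and>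
      (\<forall>u\<in>?E. \<forall>v\<in>?E. proj_metric A X u v = proj_metric A' (\<tau> X) (D u) (D v))"
    if X: "X \<in> W" for X
  proof -
    define B where "B = A + X"
    define c where "c = inverse (frob B A')"
    define D where "D = (\<lambda>u. cscale c u - cscale (frob u A' / (frob B A')\<^sup>2) B)"
    have f: "frob B A' \<noteq> 0" using X by (auto simp: W B_def)
    have c: "c \<noteq> 0" using f by (simp add: c_def)
    have "(proj_coord A' has_derivative D) (at (A + X) within (\<lambda>X. A + X) ` W)"
      using has_derivative_proj_coord[OF f] by (simp add: D_def c_def B_def)
    then have "((\<lambda>X. proj_coord A' (A + X)) has_derivative (\<lambda>u. D ((\<lambda>u. 0 + u) u))) (at X within W)"
      by (rule has_derivative_in_compose[rotated])
         (intro has_derivative_add has_derivative_const has_derivative_ident)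
    then have "(\<tau> has_derivative D) (at X within W)"
      using has_derivative_transform[OF X \<tau>] by simp
    moreover have "proj_metric A X u v = proj_metric A' (\<tau> X) (D u) (D v)"
      if "u \<in> ?E" "v \<in> ?E" for u v
    proof -
      have DE: "frob (D w) A' = 0" for w
        using f by (simp add: D_def c_def frob_diff_left frob_cscale_left power2_eq_square field_simps)
      have \<tau>E: "frob (\<tau> X) A' = 0" "A' + \<tau> X = cscale c B"
        using \<tau>[OF X] proj_coord_props(1)[OF A' f] by (simp_all add: B_def c_def proj_coord_def)
      have hD: "hor B (D w) = cscale c (hor B w)" for w
        unfolding D_def by (rule hor_cscale_self)
      have "proj_metric A' (\<tau> X) (D u) (D v) =
          (hor B (D u) \<bullet> hor B (D v)) / (norm (cscale c B))\<^sup>2"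
        by (subst proj_metric_eq[OF A' \<tau>E(1) DE DE]) (simp only: \<tau>E(2) hor_cscale[OF c])
      also have "\<dots> = (hor B u \<bullet> hor B v) / (norm B)\<^sup>2"
        using c by (simp add: hD inner_cscale_cscale norm_cscale power_mult_distrib)
      also have "\<dots> = proj_metric A X u v"
        using X that by (subst proj_metric_eq[OF A]) (auto simp: W B_def)
      finally show ?thesis by simp
    qed
    ultimately show ?thesis by blast
  qed
  show ?thesis
    unfolding riemannian_transition_def Let_def proj_chart_def rchart.simps
      W_def[symmetric] \<tau>_def[symmetric]
    by (intro conjI allI ballI 1 2 3)
qed

lemma riemannian_atlas_proj: "riemannian_atlas proj_atlas"
  unfolding riemannian_atlas_def proj_atlas_def
  by (auto intro: riemannian_chart_proj riemannian_transition_proj)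

lemma proj_atlas_covers:
  assumes "B \<noteq> 0"
  shows "\<exists>\<xi>\<in>proj_atlas. proj B \<in> rc_param \<xi> ` rc_dom \<xi>"
proof -
  have n: "norm (sgn B) = 1" using assms by (simp add: norm_sgn)
  have "frob B (sgn B) \<noteq> 0"
    using assms by (simp add: sgn_div_norm frob_scaleR_right frob_self_eq_0_iff)
  from proj_coord_props[OF n this]
  have "proj B \<in> rc_param (proj_chart (sgn B)) ` rc_dom (proj_chart (sgn B))"
    by (auto simp: proj_chart_def)
  then show ?thesis using n unfolding proj_atlas_def by (intro bexI imageI) auto
qed

end

theory Submission
  imports Defs
begin

text \<open>
  Write \<open>f B\<close> for the square of the least singular value of \<open>B\<close>. In the affine charts of the projective
  space the Fubini-Study metric is the inner product of horizontal parts divided by \<open>|B|\<^sup>2\<close>;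
  multiplied by \<open>alpha2\<close> it becomes the inner product of horizontal parts divided by \<open>f B\<close>
  (\<open>conformal_metric_eq\<close>). So the geodesics are the projections of horizontal curves that are
  geodesic for the metric \<open>|dB|\<^sup>2 / f\<close> on matrices.

  For a unit vector \<open>x\<close> the function \<open>|B\<^sup>* x|\<^sup>2\<close> is quadratic in \<open>B\<close>, and \<open>f\<close> is the infimum of these functions.
  Along a geodesic fix a time \<open>t\<close> and a minimiser \<open>x\<close> at that time. Then \<open>ln |B|\<^sup>2 - ln |B\<^sup>* x|\<^sup>2\<close>
  is a lower support of \<open>ln alpha2\<close> that touches at \<open>t\<close>, and it suffices that its second
  derivative at \<open>t\<close> is nonnegative (\<open>convex_on_real_if_lower_support\<close>). There the derivative of \<open>f\<close>
  coincides with that of the quadratic function: its gradient is \<open>2 x (B\<^sup>* x)\<^sup>*\<close>, with squared norm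
  \<open>4 f\<close>. Inserting this into the geodesic equation turns the second derivative into
  \<open>2 (|V|\<^sup>2 - |V\<^sup>* x|\<^sup>2) / f\<close>, where \<open>V\<close> is the horizontal velocity
  (\<open>geodesic_second_derivative_nonneg\<close>), and this is nonnegative because \<open>x\<close> is a unit vector.
  In particular no second derivative of \<open>f\<close> enters.

  Two preparations are needed. The list of singular values is defined by multiplicities, and its
  last entry must be identified with the variational infimum; this is the spectral theorem
  for \<open>A A\<^sup>*\<close> (\<open>eigenbasis_gram\<close>, \<open>singular_value_last\<close>). And \<open>f\<close> must be twice continuously
  differentiable where the least singular value is simple. There it solves a smooth scalar equation,
  obtained from a rank-one modification of \<open>A A\<^sup>*\<close>, whose derivative in the unknown is
  nonzero (\<open>least_sv_sq_Ck2_local\<close>).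

  The argument treats \<open>\<real>\<close> and \<open>\<complex>\<close> at once, as instances of the class \<open>conj_field\<close>.
\<close>

section \<open>The adjoint and the Gram matrix\<close>

lemma inner_mult_conjg: "(a * x) \<bullet> y = x \<bullet> (conjg a * (y :: 'k::conj_field))"
  by (metis (no_types, lifting) conjg_conjg conjg_mult inner_conjg mult.assoc mult.commute)

lemma inner_vec_scale: "(k *s x) \<bullet> y = x \<bullet> (conjg k *s (y :: 'k::conj_field^'n))"
  by (simp add: inner_vec_def inner_mult_conjg)

lemma of_real_vec_scale: "of_real r *s x = r *\<^sub>R (x :: 'k::conj_field^'n)"
  by (simp add: vec_eq_iff) (simp add: scaleR_conv_of_real[where 'a='k])

lemma inner_adjoint:
  fixes M :: "'k::conj_field^'m^'n"
  shows "(ctranspose M *v x) \<bullet> y = x \<bullet> (M *v y)"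
proof -
  have "(ctranspose M *v x) \<bullet> y = (\<Sum>j\<in>UNIV. \<Sum>i\<in>UNIV. x $ i \<bullet> (M $ i $ j * y $ j))"
    by (simp add: inner_vec_def matrix_vector_mult_def ctranspose_def inner_sum_left inner_mult_conjg)
  also have "\<dots> = (\<Sum>i\<in>UNIV. \<Sum>j\<in>UNIV. x $ i \<bullet> (M $ i $ j * y $ j))"
    by (rule sum.swap)
  finally show ?thesis
    by (simp add: inner_vec_def matrix_vector_mult_def inner_sum_right)
qed

abbreviation gram :: "'k::conj_field^'m^'n \<Rightarrow> 'k^'n^'n"
  where "gram A \<equiv> A ** ctranspose A"

lemma inner_gram: "(gram A *v x) \<bullet> y = (ctranspose A *v x) \<bullet> (ctranspose A *v y)"
  by (metis inner_adjoint inner_commute matrix_vector_mul_assoc)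

lemma mult_vec_scaleR: "M *v (r *\<^sub>R x) = r *\<^sub>R (M *v (x :: 'k::conj_field^'m))"
  by (simp add: matrix_vector_mult_def vec_eq_iff scaleR_sum_right)

lemma linear_mult_vec: "linear (\<lambda>x. M *v (x :: 'k::conj_field^'m))"
  by (intro linearI) (simp_all add: matrix_vector_right_distrib mult_vec_scaleR)

lemma nonneg_quadratic_imp_linear_coeff_0:
  fixes a b :: real
  assumes "\<And>t. 0 \<le> a * t + b * t\<^sup>2"
  shows "a = 0"
proof (rule ccontr)
  assume a: "a \<noteq> 0"
  define t where "t = - a / (2 * (\<bar>b\<bar> + 1))"
  have t: "t * (2 * (\<bar>b\<bar> + 1)) = - a"
    by (simp add: t_def)
  have "a * t + b * t\<^sup>2 \<le> a * t + (\<bar>b\<bar> + 1) * t\<^sup>2"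
    by (simp add: mult_right_mono)
  also have "\<dots> = a * t / 2"
    using t by (simp add: power2_eq_square algebra_simps) algebra
  also have "\<dots> < 0"
    using a by (simp add: t_def divide_simps) (smt (verit) mult_pos_pos mult_neg_neg)
  finally show False using assms[of t] by simp
qed

section \<open>The spectral theorem and the singular values\<close>

text \<open>
  A minimiser of the Rayleigh quotient on an invariant subspace is an eigenvector: the first
  variation in every direction of the subspace vanishes, and the residual is such a direction.
  Real subspaces and the real inner product suffice for this; the \<open>'k\<close>-linear structure enters later,
  when dimensions are counted.
\<close>

lemma gram_minimizer:
  fixes A :: "'k::conj_field^'m^'n"
  assumes T: "subspace T" and inv: "\<And>x. x \<in> T \<Longrightarrow> gram A *v x \<in> T"
    and ne: "y0 \<in> T" "y0 \<noteq> 0"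
  obtains x where "x \<in> T" "norm x = 1"
    "\<And>y. y \<in> T \<Longrightarrow> (norm (ctranspose A *v x))\<^sup>2 * (norm y)\<^sup>2 \<le> (norm (ctranspose A *v y))\<^sup>2"
    "gram A *v x = (norm (ctranspose A *v x))\<^sup>2 *\<^sub>R x"
proof -
  let ?q = "\<lambda>x. (norm (ctranspose A *v x))\<^sup>2"
  have "compact (sphere 0 1 \<inter> T)"
    by (intro compact_Int_closed compact_sphere closed_subspace T)
  moreover have "sgn y0 \<in> sphere 0 1 \<inter> T"
    using ne T by (auto simp: norm_sgn sgn_div_norm subspace_scale)
  moreover have "continuous_on (sphere 0 1 \<inter> T) ?q"
    by (intro continuous_intros linear_continuous_on linear_conv_bounded_linear[THEN iffD1] linear_mult_vec)
  ultimately obtain x where x: "x \<in> sphere 0 1 \<inter> T"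
    and min: "\<And>y. y \<in> sphere 0 1 \<inter> T \<Longrightarrow> ?q x \<le> ?q y"
    using continuous_attains_inf[of "sphere 0 1 \<inter> T" ?q] by (metis empty_iff)
  have nx: "norm x = 1" and xT: "x \<in> T" using x by auto
  have le: "?q x * (norm y)\<^sup>2 \<le> ?q y" if "y \<in> T" for y
  proof (cases "y = 0")
    case False
    have "?q x \<le> ?q (sgn y)"
      using False that T by (intro min) (auto simp: norm_sgn sgn_div_norm subspace_scale)
    also have "?q (sgn y) = ?q y / (norm y)\<^sup>2"
      by (simp add: sgn_div_norm mult_vec_scaleR power_mult_distrib divide_inverse power_inverse mult.commute)
    finally show ?thesis using False by (simp add: field_simps)
  qed simp
  have "(gram A *v x - ?q x *\<^sub>R x) \<bullet> y = 0" if y: "y \<in> T" for y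
  proof -
    let ?a = "2 * ((gram A *v x - ?q x *\<^sub>R x) \<bullet> y)" and ?b = "?q y - ?q x * (norm y)\<^sup>2"
    have "0 \<le> ?a * t + ?b * t\<^sup>2" for t
    proof -
      have "?q x * (norm (x + t *\<^sub>R y))\<^sup>2 \<le> ?q (x + t *\<^sub>R y)"
        using xT y T by (intro le) (simp add: subspace_add subspace_scale)
      moreover have "?q (x + t *\<^sub>R y) = ?q x + 2 * t * ((gram A *v x) \<bullet> y) + t\<^sup>2 * ?q y"
        unfolding inner_gram matrix_vector_right_distrib mult_vec_scaleR power2_norm_eq_inner
          inner_simps inner_commute[of "ctranspose A *v y" "ctranspose A *v x"]
        by (simp add: power2_eq_square algebra_simps)
      moreover have "(norm (x + t *\<^sub>R y))\<^sup>2 = 1 + 2 * t * (x \<bullet> y) + t\<^sup>2 * (norm y)\<^sup>2"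
        using nx unfolding power2_norm_eq_inner norm_eq_1 inner_simps inner_commute[of y x]
        by (simp add: power2_eq_square algebra_simps)
      ultimately show ?thesis by (simp add: inner_simps algebra_simps)
    qed
    from nonneg_quadratic_imp_linear_coeff_0[OF this] show ?thesis by simp
  qed
  from this[of "gram A *v x - ?q x *\<^sub>R x"] have "gram A *v x = ?q x *\<^sub>R x"
    using xT inv T by (simp add: subspace_diff subspace_scale)
  with nx xT le show thesis by (intro that) auto
qed

text \<open>
  The real orthogonal complement of the eigenvectors is invariant, because \<open>A A\<^sup>*\<close> is symmetric; if
  it were nonzero, it would contain a minimiser of the Rayleigh quotient, that is, an eigenvector
  orthogonal to itself.
\<close>

lemma span_eigenvectors_gram:
  fixes A :: "'k::conj_field^'m^'n"
  shows "span {x. \<exists>r\<ge>0. gram A *v x = r *\<^sub>R x} = UNIV"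
proof (rule ccontr)
  let ?S = "{x. \<exists>r\<ge>0. gram A *v x = r *\<^sub>R x}"
  assume "span ?S \<noteq> UNIV"
  then obtain y0 where y0: "y0 \<noteq> 0" "\<forall>x\<in>span ?S. y0 \<bullet> x = 0"
    using span_not_UNIV_orthogonal by blast
  define T where "T = {y. \<forall>x\<in>?S. y \<bullet> x = 0}"
  have "subspace T"
    by (auto simp: T_def subspace_def inner_simps)
  moreover have "gram A *v y \<in> T" if "y \<in> T" for y
  proof -
    have "(gram A *v y) \<bullet> x = y \<bullet> (gram A *v x)" for x
      by (metis inner_commute inner_gram)
    with that show ?thesis by (auto simp: T_def)
  qed
  moreover have "y0 \<in> T"
    using y0(2) by (auto simp: T_def intro: span_base)
  ultimately obtain x where x: "x \<in> T" "norm x = 1"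
    "gram A *v x = (norm (ctranspose A *v x))\<^sup>2 *\<^sub>R x"
    using gram_minimizer[of T A] y0(1) by metis
  then have "x \<in> ?S" by (auto intro: exI[of _ "(norm (ctranspose A *v x))\<^sup>2"])
  with x show False by (auto simp: T_def)
qed

text \<open>
  The basis is only required to be independent, not orthonormal: this already identifies
  each eigenspace with the span of the basis vectors for its eigenvalue, since comparing
  coefficients in \<open>A A\<^sup>* x = s x\<close> kills all others.
\<close>

lemma eigenbasis_gram:
  fixes A :: "'k::conj_field^'m^'n"
  obtains B r where "finite B" "card B = CARD('n)" "vec.independent B"
    "\<And>b. b \<in> B \<Longrightarrow> 0 \<le> r b \<and> gram A *v b = of_real (r b) *s b"
    "\<And>s. vec.dim {x. gram A *v x = of_real s *s x} = card {b\<in>B. r b = s}"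
proof -
  let ?S = "{x. \<exists>r\<ge>0. gram A *v x = r *\<^sub>R x}"
  obtain B where B: "B \<subseteq> ?S" "vec.independent B" "?S \<subseteq> vec.span B"
    using vec.maximal_independent_subset[of ?S] by blast
  have "subspace (vec.span B)"
    unfolding subspace_def
    by (metis of_real_vec_scale vec.span_add vec.span_scale vec.span_zero)
  then have spB: "vec.span B = UNIV"
    using span_minimal[OF B(3)] span_eigenvectors_gram[of A] by auto
  have fin: "finite B" using B(2) vec.finiteI_independent by blast
  have card: "card B = CARD('n)"
    using vec.dim_eq_card_independent[OF B(2)] vec.dim_span[of B] vec_dim_card[where 'a='k and 'n='n]
    by (simp add: spB)
  have "\<forall>b\<in>B. \<exists>r\<ge>0. gram A *v b = r *\<^sub>R b" using B(1) by auto
  then obtain r where r: "\<And>b. b \<in> B \<Longrightarrow> 0 \<le> r b \<and> gram A *v b = of_real (r b) *s b"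
    unfolding of_real_vec_scale by metis
  have "vec.dim {x. gram A *v x = of_real s *s x} = card {b\<in>B. r b = s}" for s
  proof (rule vec.dim_unique)
    show "{b \<in> B. r b = s} \<subseteq> {x. gram A *v x = of_real s *s x}" using r by auto
    show "vec.independent {b \<in> B. r b = s}"
      using B(2) vec.independent_mono by (metis (no_types, lifting) mem_Collect_eq subsetI)
    show "{x. gram A *v x = of_real s *s x} \<subseteq> vec.span {b \<in> B. r b = s}"
    proof safe
      fix x assume x: "gram A *v x = of_real s *s x"
      obtain c where c: "x = (\<Sum>b\<in>B. c b *s b)"
        using spB vec.span_finite[OF fin] by fastforce
      have "(\<Sum>b\<in>B. (c b * of_real (r b - s)) *s b) = gram A *v x - of_real s *s x"
      proof -
        have "gram A *v x = (\<Sum>b\<in>B. c b *s (gram A *v b))"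
          unfolding c by (simp only: vec.linear_sum[OF matrix_vector_mul_linear_gen] vec.linear_scale[OF matrix_vector_mul_linear_gen])
        also have "\<dots> = (\<Sum>b\<in>B. (c b * of_real (r b)) *s b)"
          using r by (intro sum.cong) (auto simp: vector_smult_assoc)
        finally show ?thesis
          by (simp only: c vec.scale_sum_right sum_subtractf[symmetric] vector_smult_assoc
              vector_sub_rdistrib[symmetric] of_real_diff right_diff_distrib mult.commute)
      qed
      then have "(\<Sum>b\<in>B. (c b * of_real (r b - s)) *s b) = 0" using x by simp
      then have "c b * of_real (r b - s) = 0" if "b \<in> B" for b
        using vec.independentD[OF B(2) fin order_refl, of "\<lambda>b. c b * of_real (r b - s)"] that by simp
      then have c0: "c b = 0" if "b \<in> B" "r b \<noteq> s" for b
        using that by (metis mult_eq_0_iff of_real_eq_0_iff right_minus_eq)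
      have "x = (\<Sum>b\<in>{b\<in>B. r b = s}. c b *s b)"
        unfolding c by (rule sum.mono_neutral_right) (use fin c0 in auto)
      then show "x \<in> vec.span {b \<in> B. r b = s}"
        by (simp only:) (intro vec.span_sum vec.span_scale vec.span_base, simp)
    qed
  qed simp
  with fin card B(2) r show thesis by (intro that)
qed

text \<open>
  The square of the least singular value, in the variational form on which everything below rests:
  an infimum of functions that are quadratic in \<open>A\<close>.
\<close>

definition least_sv_sq :: "'k::conj_field^'m^'n \<Rightarrow> real"
  where "least_sv_sq A = (INF x\<in>sphere 0 1. (norm (ctranspose A *v x))\<^sup>2)"

lemma least_sv_sq_le:
  assumes "norm x = 1"
  shows "least_sv_sq A \<le> (norm (ctranspose A *v x))\<^sup>2"
  unfolding least_sv_sq_def by (rule cINF_lower) (use assms in \<open>auto intro: bdd_belowI[of _ 0]\<close>)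

lemma least_sv_sq_attained:
  fixes A :: "'k::conj_field^'m^'n"
  obtains x where "norm x = 1" "(norm (ctranspose A *v x))\<^sup>2 = least_sv_sq A"
    "gram A *v x = least_sv_sq A *\<^sub>R x"
proof -
  have "(1 :: 'k^'n) \<noteq> 0" by (simp add: vec_eq_iff)
  then obtain x where x: "norm x = 1"
    "\<And>y. (norm (ctranspose A *v x))\<^sup>2 * (norm y)\<^sup>2 \<le> (norm (ctranspose A *v y))\<^sup>2"
    "gram A *v x = (norm (ctranspose A *v x))\<^sup>2 *\<^sub>R x"
    using gram_minimizer[of UNIV A 1] by (metis UNIV_I subspace_UNIV)
  have "(norm (ctranspose A *v x))\<^sup>2 \<le> least_sv_sq A"
    unfolding least_sv_sq_def
  proof (rule cINF_greatest)
    show "sphere 0 1 \<noteq> ({} :: ('k^'n) set)" using x(1) by force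
    show "(norm (ctranspose A *v x))\<^sup>2 \<le> (norm (ctranspose A *v y))\<^sup>2" if "y \<in> sphere 0 1" for y
      using x(2)[of y] that by simp
  qed
  with least_sv_sq_le[OF x(1), of A] have "(norm (ctranspose A *v x))\<^sup>2 = least_sv_sq A" by simp
  with x(1,3) show thesis by (intro that) auto
qed

lemma least_sv_sq_mult_le: "least_sv_sq A * (norm y)\<^sup>2 \<le> (norm (ctranspose A *v y))\<^sup>2"
proof (cases "y = 0")
  case False
  then have "least_sv_sq A \<le> (norm (ctranspose A *v sgn y))\<^sup>2"
    by (intro least_sv_sq_le) (simp add: norm_sgn)
  then show ?thesis
    using False by (simp add: sgn_div_norm mult_vec_scaleR power_mult_distrib divide_simps)
qed simp

text \<open>
  Uniqueness half of the description that defines \<open>singular_values\<close>.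
\<close>

lemma sorted_desc_count_unique:
  fixes xs ys :: "real list"
  assumes "sorted_wrt (\<ge>) xs" "sorted_wrt (\<ge>) ys" "\<And>s. count_list xs s = count_list ys s"
  shows "xs = ys"
proof -
  have "mset xs = mset ys"
    using assms(3) by (intro multiset_eqI) (simp add: count_mset)
  moreover have "sorted (rev xs)" "sorted (rev ys)"
    using assms(1,2) by (simp_all add: sorted_wrt_rev)
  ultimately have "rev xs = rev ys"
    by (metis mset_rev properties_for_sort)
  then show ?thesis by simp
qed

text \<open>
  Existence: the roots of the eigenvalues of an eigenbasis, sorted, have the required multiplicities,
  so that the definite description in \<open>singular_values\<close> denotes.
\<close>

lemma singular_values_props:
  fixes A :: "'k::conj_field^'m^'n"
  shows "length (singular_values A) = CARD('n)" "sorted_wrt (\<ge>) (singular_values A)"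
    "\<And>s. s \<in> set (singular_values A) \<Longrightarrow> 0 \<le> s"
    "\<And>s. 0 \<le> s \<Longrightarrow> count_list (singular_values A) s = vec.dim {x. gram A *v x = s\<^sup>2 *\<^sub>R x}"
proof -
  let ?P = "\<lambda>xs. length xs = CARD('n) \<and> sorted_wrt (\<ge>) xs \<and> (\<forall>s\<in>set xs. 0 \<le> s) \<and>
    (\<forall>s\<ge>0. count_list xs s = vec.dim {x. gram A *v x = of_real (s\<^sup>2) *s x})"
  obtain B r where B: "finite B" "card B = CARD('n)" "vec.independent B"
    "\<And>b. b \<in> B \<Longrightarrow> 0 \<le> r b \<and> gram A *v b = of_real (r b) *s b"
    "\<And>s. vec.dim {x. gram A *v x = of_real s *s x} = card {b\<in>B. r b = s}"
    using eigenbasis_gram[of A] by blast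
  obtain bs where bs: "set bs = B" "distinct bs"
    using finite_distinct_list[OF B(1)] by blast
  define xs where "xs = rev (sort (map (\<lambda>b. sqrt (r b)) bs))"
  have "count_list xs s = vec.dim {x. gram A *v x = of_real (s\<^sup>2) *s x}" if "0 \<le> s" for s
  proof -
    have "count_list xs s = length (filter (\<lambda>b. s = sqrt (r b)) bs)"
      by (simp add: xs_def count_list_eq_length_filter filter_map o_def filter_sort
          flip: rev_filter)
    also have "\<dots> = card {b\<in>B. s = sqrt (r b)}"
      using bs by (metis distinct_card distinct_filter set_filter)
    also have "{b\<in>B. s = sqrt (r b)} = {b\<in>B. r b = s\<^sup>2}"
      using that B(4) by (auto simp: real_sqrt_unique)
    finally show ?thesis unfolding B(5) .
  qed
  moreover have "length xs = CARD('n)"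
    using bs B(2) distinct_card[of bs] by (simp add: xs_def)
  moreover have "sorted_wrt (\<ge>) xs"
    by (simp add: xs_def sorted_wrt_rev)
  moreover have "\<forall>s\<in>set xs. 0 \<le> s"
    using B(4) bs by (auto simp: xs_def)
  ultimately have P: "?P xs"
    by blast
  have uniq: "ys = xs" if ys: "?P ys" for ys
  proof (rule sorted_desc_count_unique)
    show "sorted_wrt (\<ge>) xs" "sorted_wrt (\<ge>) ys" using ys P by auto
    show "count_list ys s = count_list xs s" for s
    proof (cases "0 \<le> s")
      case False
      then have "s \<notin> set ys" "s \<notin> set xs" using ys P by auto
      then show ?thesis by (simp add: count_notin)
    qed (use ys P in auto)
  qed
  have "?P (singular_values A)"
    unfolding singular_values_def by (rule theI[of ?P, OF P uniq])
  then show "length (singular_values A) = CARD('n)" "sorted_wrt (\<ge>) (singular_values A)"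
    "\<And>s. s \<in> set (singular_values A) \<Longrightarrow> 0 \<le> s"
    "\<And>s. 0 \<le> s \<Longrightarrow> count_list (singular_values A) s = vec.dim {x. gram A *v x = s\<^sup>2 *\<^sub>R x}"
    by (simp_all only: of_real_vec_scale)
qed

lemma mem_singular_values_iff:
  assumes "0 \<le> s"
  shows "s \<in> set (singular_values A) \<longleftrightarrow> (\<exists>x. x \<noteq> 0 \<and> gram A *v x = s\<^sup>2 *\<^sub>R x)"
proof -
  have "s \<in> set (singular_values A) \<longleftrightarrow> vec.dim {x. gram A *v x = s\<^sup>2 *\<^sub>R x} \<noteq> 0"
    using singular_values_props(4)[OF assms, of A] count_list_0_iff by metis
  also have "\<dots> \<longleftrightarrow> \<not> {x. gram A *v x = s\<^sup>2 *\<^sub>R x} \<subseteq> {0}"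
    by simp
  finally show ?thesis by auto
qed

text \<open>
  The minimum of the Rayleigh quotient is an eigenvalue, hence occurs in the list, and no
  eigenvalue lies below it; the last entry of a decreasing list is its least one.
\<close>

lemma singular_value_last:
  fixes A :: "'k::conj_field^'m^'n"
  shows "singular_value CARD('n) A = sqrt (least_sv_sq A)"
proof (rule antisym)
  let ?xs = "singular_values A"
  have len: "length ?xs - 1 < length ?xs" "length ?xs = CARD('n)"
    using singular_values_props(1)[of A] by simp_all
  have last: "singular_value CARD('n) A = ?xs ! (length ?xs - 1)"
    by (simp add: singular_value_def len)
  have mem: "singular_value CARD('n) A \<in> set ?xs"
    unfolding last using len by simp
  obtain x where x: "norm x = 1" "(norm (ctranspose A *v x))\<^sup>2 = least_sv_sq A"
    "gram A *v x = least_sv_sq A *\<^sub>R x"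
    using least_sv_sq_attained[of A] .
  have nn: "0 \<le> least_sv_sq A" using x(2) by (metis zero_le_power2)
  have "sqrt (least_sv_sq A) \<in> set ?xs"
    using x nn by (subst mem_singular_values_iff) (auto intro!: exI[of _ x])
  then obtain i where "i < length ?xs" "?xs ! i = sqrt (least_sv_sq A)"
    by (auto simp: in_set_conv_nth)
  then show "singular_value CARD('n) A \<le> sqrt (least_sv_sq A)"
    using sorted_wrt_nth_less[OF singular_values_props(2)[of A], of i "length ?xs - 1"] len(1)
    unfolding last by (cases "i = length ?xs - 1") auto
  obtain z where z: "z \<noteq> 0" "gram A *v z = (singular_value CARD('n) A)\<^sup>2 *\<^sub>R z"
    using mem mem_singular_values_iff singular_values_props(3) by metis
  have "least_sv_sq A * (norm z)\<^sup>2 \<le> (gram A *v z) \<bullet> z"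
    using least_sv_sq_mult_le[of A z] by (simp add: inner_gram power2_norm_eq_inner)
  also have "\<dots> = (singular_value CARD('n) A)\<^sup>2 * (norm z)\<^sup>2"
    by (simp add: z(2) power2_norm_eq_inner)
  finally have "least_sv_sq A \<le> (singular_value CARD('n) A)\<^sup>2"
    using z(1) by simp
  then show "sqrt (least_sv_sq A) \<le> singular_value CARD('n) A"
    using mem singular_values_props(3)[of "singular_value CARD('n) A" A] real_le_lsqrt by auto
qed

section \<open>Matrices whose least singular value is positive and simple\<close>

text \<open>
  Simplicity of the least singular value as a statement on its eigenspace, which is how the implicit
  function argument uses it.
\<close>

definition simple_least :: "('k::conj_field^'m^'n) set"
  where "simple_least = {A. 0 < least_sv_sq A \<and>
    (\<exists>x. norm x = 1 \<and> (\<forall>z. gram A *v z = least_sv_sq A *\<^sub>R z \<longrightarrow> (\<exists>k. z = k *s x)))}"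

text \<open>
  Full rank gives a right inverse \<open>B\<close> of \<open>A\<close>, and then \<open>A\<^sup>* x = 0\<close> forces \<open>x \<bullet> A (B x) = 0\<close>, that is,
  \<open>x = 0\<close>.
\<close>

lemma full_rank_least_sv_sq_pos:
  fixes A :: "'k::conj_field^'m^'n"
  assumes "rank A = CARD('n)"
  shows "0 < least_sv_sq A"
proof -
  have "\<exists>B :: 'k^'n^'m. A ** B = mat 1"
  proof -
    have "rows A = range (\<lambda>i. A $ i)"
      by (auto simp: rows_def row_def)
    then have "card (rows A) \<le> CARD('n)" "finite (rows A)"
      by (simp_all add: card_image_le)
    moreover have "vec.dim (rows A) = CARD('n)"
      using assms by (simp add: row_rank_def_gen)
    ultimately have c: "card (rows A) = CARD('n)" "vec.independent (rows A)"
      using vec.dim_le_card'[of "rows A"] vec.card_eq_dim[of "rows A" "rows A"]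
      by (auto simp: vec.span_superset)
    then have inj: "inj (\<lambda>i. A $ i)"
      using \<open>rows A = _\<close> by (metis eq_card_imp_inj_on finite)
    have "\<forall>i. c i = 0" if "(\<Sum>i\<in>UNIV. c i *s row i A) = 0" for c
    proof
      fix i
      have "(\<Sum>v\<in>rows A. c (inv (\<lambda>i. A $ i) v) *s v) = 0"
        unfolding \<open>rows A = _\<close>
        by (subst sum.reindex[OF inj]) (use that inj in \<open>simp add: row_def inv_f_f\<close>)
      then have "c (inv (\<lambda>i. A $ i) (A $ i)) = 0"
        by (rule vec.independentD[OF c(2) \<open>finite (rows A)\<close> order_refl, where u="\<lambda>v. c (inv (\<lambda>i. A $ i) v)"])
           (simp add: \<open>rows A = _\<close>)
      then show "c i = 0" using inj by (simp add: inv_f_f)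
    qed
    then show ?thesis
      unfolding matrix_right_invertible_independent_rows by blast
  qed
  then obtain B :: "'k^'n^'m" where B: "A ** B = mat 1" by blast
  obtain x where x: "norm x = 1" "(norm (ctranspose A *v x))\<^sup>2 = least_sv_sq A"
    using least_sv_sq_attained[of A] .
  have "ctranspose A *v x \<noteq> 0"
  proof
    assume "ctranspose A *v x = 0"
    then have "x \<bullet> (A *v (B *v x)) = 0"
      by (metis inner_adjoint inner_zero_left)
    then show False using x(1) B by (simp add: matrix_vector_mul_assoc)
  qed
  then show ?thesis unfolding x(2)[symmetric] by simp
qed

text \<open>
  A gap between the last two entries means that the last one occurs once, so that its eigenspace
  has dimension one.
\<close>

lemma GL_simple_subset_simple_least:
  "GL_simple \<subseteq> (simple_least :: ('k::conj_field^'m^'n) set)"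
proof
  fix A :: "'k^'m^'n" assume A: "A \<in> GL_simple"
  then have pos: "0 < least_sv_sq A"
    by (auto simp: GL_simple_def intro: full_rank_least_sv_sq_pos)
  let ?s = "sqrt (least_sv_sq A)" and ?xs = "singular_values A" and ?n = "CARD('n)"
  have len: "length ?xs = ?n" by (rule singular_values_props)
  have "count_list ?xs ?s \<le> 1"
  proof -
    obtain ys y where ys: "?xs = ys @ [y]" "length ys = ?n - 1"
      using len by (cases ?xs rule: rev_cases) auto
    have y: "y = ?s"
      using singular_value_last[of A] ys by (simp add: singular_value_def nth_append)
    have "?s \<notin> set ys"
    proof
      assume "?s \<in> set ys"
      then obtain i where i: "i < ?n - 1" "ys ! i = ?s" using ys by (auto simp: in_set_conv_nth)
      then have n2: "2 \<le> ?n" by simp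
      then have "singular_value (?n - 1) A > ?s"
        using A singular_value_last[of A] by (auto simp: GL_simple_def)
      moreover have "singular_value (?n - 1) A = ys ! (?n - 2)"
        using n2 ys by (auto simp: singular_value_def nth_append numeral_2_eq_2)
      moreover have "ys ! (?n - 2) \<le> ys ! i"
      proof -
        have "sorted_wrt (\<ge>) ys"
          using singular_values_props(2)[of A] ys by (simp add: sorted_wrt_append)
        then show ?thesis
          using sorted_wrt_nth_less[of "(\<ge>)" ys i "?n - 2"] i n2 ys by (cases "i = ?n - 2") auto
      qed
      ultimately show False using i by simp
    qed
    then show ?thesis unfolding ys y by (simp add: count_notin)
  qed
  then have dim: "vec.dim {x. gram A *v x = least_sv_sq A *\<^sub>R x} \<le> 1"
    using singular_values_props(4)[of ?s A] pos by simp
  obtain x where x: "norm x = 1" "gram A *v x = least_sv_sq A *\<^sub>R x"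
    using least_sv_sq_attained[of A] .
  have "x \<noteq> 0" using x(1) by auto
  have "\<exists>k. z = k *s x" if "gram A *v z = least_sv_sq A *\<^sub>R z" for z
  proof -
    have "vec.independent {x}" using \<open>x \<noteq> 0\<close> by simp
    then have "{x. gram A *v x = least_sv_sq A *\<^sub>R x} \<subseteq> vec.span {x}"
      using dim x(2) by (intro vec.card_ge_dim_independent) auto
    then show ?thesis using that by (auto simp: vec.span_singleton)
  qed
  then show "A \<in> simple_least"
    using pos x(1) by (auto simp: simple_least_def)
qed

section \<open>Scaling, and the function on lines\<close>

lemma ctranspose_cscale_mult: "ctranspose (cscale c A) *v x = conjg c *s (ctranspose A *v x)"
  by (simp add: vec_eq_iff ctranspose_def cscale_def matrix_vector_mult_def conjg_mult sum_distrib_left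
      mult.assoc)

lemma norm_conjg: "norm (conjg c) = norm (c :: 'k::conj_field)"
proof -
  have "(of_real ((norm (conjg c))\<^sup>2) :: 'k) = of_real ((norm c)\<^sup>2)"
    by (metis conjg_conjg mult.commute mult_conjg_self')
  then show ?thesis by (simp only: of_real_eq_iff) (simp add: power2_eq_iff_nonneg)
qed

lemma norm_vec_scale: "norm (k *s x) = norm k * norm (x :: 'k::conj_field^'n)"
  by (simp add: norm_vec_def L2_set_def norm_mult power_mult_distrib sum_distrib_left[symmetric] real_sqrt_mult)

lemma least_sv_sq_cscale: "least_sv_sq (cscale c A) = (norm c)\<^sup>2 * least_sv_sq A"
proof (rule antisym)
  obtain x where x: "norm x = 1" "(norm (ctranspose A *v x))\<^sup>2 = least_sv_sq A"
    using least_sv_sq_attained[of A] .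
  show "least_sv_sq (cscale c A) \<le> (norm c)\<^sup>2 * least_sv_sq A"
    using least_sv_sq_le[OF x(1), of "cscale c A"] x(2)
    by (simp add: ctranspose_cscale_mult norm_vec_scale norm_conjg power_mult_distrib)
  obtain y where y: "norm y = 1" "(norm (ctranspose (cscale c A) *v y))\<^sup>2 = least_sv_sq (cscale c A)"
    using least_sv_sq_attained[of "cscale c A"] .
  show "(norm c)\<^sup>2 * least_sv_sq A \<le> least_sv_sq (cscale c A)"
    using mult_left_mono[OF least_sv_sq_le[OF y(1), of A], of "(norm c)\<^sup>2"] y(2)
    by (simp add: ctranspose_cscale_mult norm_vec_scale norm_conjg power_mult_distrib)
qed

lemma simple_least_cscale:
  assumes "c \<noteq> 0" "A \<in> simple_least"
  shows "cscale c A \<in> simple_least"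
proof -
  have "gram (cscale c A) *v z = (norm c)\<^sup>2 *\<^sub>R (gram A *v z)" for z
  proof -
    have "gram (cscale c A) = cscale (c * conjg c) (gram A)"
      by (simp add: vec_eq_iff ctranspose_def cscale_def matrix_matrix_mult_def conjg_mult sum_distrib_left
        algebra_simps)
    then show ?thesis
      by (simp only: mult_conjg_self' cscale_of_real)
         (simp add: vec_eq_iff matrix_vector_mult_def scaleR_sum_right)
  qed
  with assms show ?thesis
    by (auto simp: simple_least_def least_sv_sq_cscale simp flip: scaleR_scaleR)
qed

text \<open>
  Numerator and denominator both scale with the squared modulus of the factor, so the set whose
  only element \<open>alpha2\<close> takes is indeed a singleton.
\<close>

lemma alpha2_proj: "alpha2 (proj B) = (norm B)\<^sup>2 / least_sv_sq B"
proof -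
  have "0 \<le> least_sv_sq B" for B :: "'a^'b^'c"
    using least_sv_sq_attained[of B] by (metis zero_le_power2)
  then have "(\<lambda>A. (norm A)\<^sup>2 * inverse ((singular_value CARD('c) A)\<^sup>2)) ` proj B = {(norm B)\<^sup>2 / least_sv_sq B}"
    unfolding proj_def singular_value_last
    by (auto simp: least_sv_sq_cscale norm_cscale power_mult_distrib divide_inverse image_iff
        intro!: exI[of _ "1 :: 'a"])
  then show ?thesis
    by (simp add: alpha2_def)
qed

section \<open>Calculus of relatively \<open>C\<^sup>k\<close> maps\<close>

lemma Ck_on_bounded_linear:
  assumes "bounded_linear h" "Ck_on k E V f"
  shows "Ck_on k E V (\<lambda>x. h (f x))"
  using Ck_on_bilinear[OF bounded_bilinear.comp[OF bounded_bilinear_scaleR bounded_linear_ident assms(1)]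
      Ck_on_const assms(2), of 1]
  by simp

lemma Ck_on_imp_continuous_on: "Ck_on k E V f \<Longrightarrow> continuous_on V f"
proof (induction k)
  case (Suc k)
  then show ?case using Ck_on_lower by blast
qed simp

lemma Ck_on_sum:
  assumes "\<And>i. i \<in> I \<Longrightarrow> Ck_on k E V (f i)"
  shows "Ck_on k E V (\<lambda>x. \<Sum>i\<in>I. f i x)"
  using assms by (induction I rule: infinite_finite_induct) (auto intro: Ck_on_add Ck_on_const)

lemma Ck_on_prod:
  fixes f :: "'i \<Rightarrow> _ \<Rightarrow> 'a::real_normed_field"
  assumes "\<And>i. i \<in> I \<Longrightarrow> Ck_on k E V (f i)"
  shows "Ck_on k E V (\<lambda>x. \<Prod>i\<in>I. f i x)"
  using assms
  by (induction I rule: infinite_finite_induct)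
     (auto intro: Ck_on_bilinear[OF bounded_bilinear_mult] Ck_on_const)

lemma Ck_on_det:
  fixes M :: "_ \<Rightarrow> 'a::real_normed_field^'n^'n"
  assumes "\<And>i j. Ck_on k E V (\<lambda>x. M x $ i $ j)"
  shows "Ck_on k E V (\<lambda>x. det (M x))"
  unfolding det_def
  by (intro Ck_on_sum Ck_on_bilinear[OF bounded_bilinear_mult] Ck_on_const Ck_on_prod assms)

text \<open>
  By the chain rule the derivative is \<open>D' (g x) (D x u)\<close>, where both the point and the direction
  depend on \<open>x\<close>. Expanding the direction in a basis separates the two and leaves sums of products of
  maps to which the induction hypothesis applies.
\<close>

lemma Ck_on_compose:
  fixes f :: "'e::euclidean_space \<Rightarrow> 'b::real_normed_vector"
  assumes "g ` V \<subseteq> W"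
  shows "Ck_on k E V g \<Longrightarrow> Ck_on k UNIV W f \<Longrightarrow> Ck_on k E V (\<lambda>x. f (g x))"
proof (induction k arbitrary: f)
  case 0
  then show ?case using assms by (auto intro: continuous_on_compose2)
next
  case (Suc k)
  from Suc.prems(1) obtain D where
    D_raw: "\<forall>x\<in>V. (g has_derivative D x) (at x within V)" "\<forall>u\<in>E. Ck_on k E V (\<lambda>x. D x u)"
    by auto
  from Suc.prems(2) obtain D' where
    D'_raw: "\<forall>y\<in>W. (f has_derivative D' y) (at y within W)" "\<forall>u. Ck_on k UNIV W (\<lambda>y. D' y u)"
    by auto
  note D = D_raw[rule_format] and D' = D'_raw[rule_format]
  have g: "Ck_on k E V g" using Suc.prems(1) Ck_on_lower by blast
  have der: "((\<lambda>x. f (g x)) has_derivative (\<lambda>u. D' (g x) (D x u))) (at x within V)" if "x \<in> V" for x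
    using that assms
    by (intro has_derivative_in_compose[OF D(1)] has_derivative_subset[OF D'(1)]) auto
  have Ck: "Ck_on k E V (\<lambda>x. D' (g x) (D x u))" if "u \<in> E" for u
  proof -
    have eq: "D' (g x) (D x u) = (\<Sum>b\<in>Basis. (D x u \<bullet> b) *\<^sub>R D' (g x) b)" if "x \<in> V" for x
    proof -
      have lin: "linear (D' (g x))"
        using that assms by (intro has_derivative_linear[OF D'(1)]) auto
      have "D' (g x) (D x u) = D' (g x) (\<Sum>b\<in>Basis. (D x u \<bullet> b) *\<^sub>R b)"
        by (simp only: euclidean_representation)
      then show ?thesis
        by (simp only: linear_sum[OF lin] linear_scale[OF lin])
    qed
    have "Ck_on k E V (\<lambda>x. \<Sum>b\<in>Basis. (D x u \<bullet> b) *\<^sub>R D' (g x) b)"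
      using D(2)[OF that]
      by (intro Ck_on_sum Ck_on_bilinear[OF bounded_bilinear_scaleR] Suc.IH g D'(2)
          Ck_on_bounded_linear[OF bounded_linear_inner_left])
    then show ?thesis
      by (rule iffD2[OF Ck_on_cong, rotated]) (rule eq)
  qed
  show ?case
    unfolding Ck_on.simps by (intro exI[of _ "\<lambda>x u. D' (g x) (D x u)"] conjI ballI der Ck)
qed

text \<open>
  On open sets the derivative is unique, so the local derivatives agree with
  \<open>frechet_derivative\<close> and fit together.
\<close>

lemma Ck_on_local:
  fixes f :: "'e::euclidean_space \<Rightarrow> 'b::real_normed_vector"
  assumes "\<And>x. x \<in> V \<Longrightarrow> \<exists>W. open W \<and> x \<in> W \<and> Ck_on k UNIV W f"
  shows "Ck_on k UNIV V f"
  using assms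
proof (induction k arbitrary: f)
  case 0
  have "isCont f x" if x: "x \<in> V" for x
  proof -
    obtain W where "open W" "x \<in> W" "continuous_on W f"
      using "0.prems"[OF x] by auto
    then show ?thesis by (simp add: continuous_on_eq_continuous_at)
  qed
  then show ?case by (simp add: continuous_at_imp_continuous_on)
next
  case (Suc k)
  let ?D = "\<lambda>x. frechet_derivative f (at x)"
  have *: "\<exists>W. open W \<and> x \<in> W \<and> (\<forall>y\<in>W. (f has_derivative ?D y) (at y)) \<and>
      (\<forall>u. Ck_on k UNIV W (\<lambda>y. ?D y u))" if x: "x \<in> V" for x
  proof -
    obtain W D where W: "open W" "x \<in> W" "\<And>y. y \<in> W \<Longrightarrow> (f has_derivative D y) (at y within W)"
      "\<And>u. Ck_on k UNIV W (\<lambda>y. D y u)"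
      using Suc.prems[OF x] by auto
    have D: "(f has_derivative D y) (at y)" if "y \<in> W" for y
      using W(1,3) that by (metis at_within_open)
    then have eq: "?D y = D y" if "y \<in> W" for y
      using that frechet_derivative_at by metis
    then have "Ck_on k UNIV W (\<lambda>y. ?D y u)" for u
      using W(4)[of u] by (subst Ck_on_cong[of W _ "\<lambda>y. D y u"]) auto
    with W D eq show ?thesis by metis
  qed
  have der: "(f has_derivative ?D x) (at x within V)" if "x \<in> V" for x
    using *[OF that] has_derivative_at_withinI by blast
  have Ck: "Ck_on k UNIV V (\<lambda>x. ?D x u)" for u
    using * by (intro Suc.IH) blast
  show ?case
    unfolding Ck_on.simps by (intro exI[of _ ?D] conjI ballI der Ck)
qed

text \<open>
  Implicit differentiation of a function that is already known to exist. A Lipschitz estimate at the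
  point replaces the contraction argument of the implicit function theorem: it makes the
  remainder in \<open>D (z - x, l z - l x) = o(\<dots>)\<close> small compared with \<open>z - x\<close> alone.
\<close>

lemma has_derivative_implicit_real:
  fixes l :: "'a::real_normed_vector \<Rightarrow> real"
  assumes \<phi>: "(\<phi> has_derivative D) (at (x, l x))"
    and const: "\<forall>\<^sub>F z in nhds x. \<phi> (z, l z) = (c :: real)"
    and lip: "\<forall>\<^sub>F z in nhds x. \<bar>l z - l x\<bar> \<le> L * norm (z - x)"
    and ne: "D (0, 1) \<noteq> 0"
  shows "(l has_derivative (\<lambda>u. - (D (u, 0) / D (0, 1)))) (at x)"
  unfolding has_derivative_at_alt
proof (intro conjI allI impI)
  have bl: "bounded_linear D" using \<phi> by (rule has_derivative_bounded_linear)
  have "bounded_linear (\<lambda>u. D (u, 0))"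
    by (rule bounded_linear_compose[OF bl]) (intro bounded_linear_Pair bounded_linear_ident bounded_linear_zero)
  then have "bounded_linear (\<lambda>u. D (u, 0) * (- inverse (D (0, 1))))"
    by (rule bounded_linear_mult_const)
  then show "bounded_linear (\<lambda>u. - (D (u, 0) / D (0, 1)))"
    by (simp add: divide_inverse)
  fix e :: real assume e: "0 < e"
  define K where "K = 1 + \<bar>L\<bar>"
  have K: "K > 0" by (simp add: K_def)
  define e' where "e' = e * \<bar>D (0, 1)\<bar> / K"
  have e': "0 < e'" using e ne K by (simp add: e'_def)
  from \<phi> e' obtain d where d: "d > 0"
    "\<And>y. norm (y - (x, l x)) < d \<Longrightarrow> norm (\<phi> y - \<phi> (x, l x) - D (y - (x, l x))) \<le> e' * norm (y - (x, l x))"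
    unfolding has_derivative_at_alt by blast
  have "\<forall>\<^sub>F z in nhds x. dist z x < d / K"
    using d K by (intro eventually_nhds_ball[THEN eventually_mono]) (auto simp: dist_commute)
  with const lip have "\<forall>\<^sub>F z in nhds x. norm (l z - l x - - (D (z - x, 0) / D (0, 1))) \<le> e * norm (z - x)"
  proof eventually_elim
    case (elim z)
    have c: "\<phi> (x, l x) = c" using const eventually_nhds_x_imp_x by blast
    have "norm ((z, l z) - (x, l x)) \<le> norm (z - x) + \<bar>l z - l x\<bar>"
      using norm_Pair_le[of "z - x" "l z - l x"] by simp
    also have "\<dots> \<le> norm (z - x) + \<bar>L\<bar> * norm (z - x)"
      using elim(2) by (smt (verit) mult_right_mono norm_ge_zero)
    finally have n: "norm ((z, l z) - (x, l x)) \<le> K * norm (z - x)"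
      by (simp add: K_def algebra_simps)
    also have "\<dots> < d" using elim(3) K by (simp add: dist_norm field_simps)
    finally have "norm (D (z - x, l z - l x)) \<le> e' * norm ((z, l z) - (x, l x))"
      using d(2)[of "(z, l z)"] elim(1) c by simp
    also have "\<dots> \<le> e' * (K * norm (z - x))"
      using n e' by (intro mult_left_mono) auto
    also have "\<dots> = e * norm (z - x) * \<bar>D (0, 1)\<bar>"
      using K by (simp add: e'_def)
    finally have "\<bar>D (z - x, l z - l x) / D (0, 1)\<bar> \<le> e * norm (z - x)"
      using ne by (simp add: abs_divide divide_le_eq)
    moreover have "D (z - x, l z - l x) = D (z - x, 0) + (l z - l x) * D (0, 1)"
    proof -
      have "(z - x, l z - l x) = (z - x, 0) + (l z - l x) *\<^sub>R (0, 1)"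
        by simp
      then have "D (z - x, l z - l x) = D ((z - x, 0) + (l z - l x) *\<^sub>R (0, 1))"
        by (rule arg_cong)
      also have "\<dots> = D (z - x, 0) + (l z - l x) *\<^sub>R D (0, 1)"
        by (simp only: linear_add[OF bounded_linear.linear[OF bl]] linear_scale[OF bounded_linear.linear[OF bl]])
      finally show ?thesis by simp
    qed
    ultimately show ?case using ne by (simp add: add_divide_distrib add.commute)
  qed
  then show "\<exists>d>0. \<forall>y. norm (y - x) < d \<longrightarrow> norm (l y - l x - - (D (y - x, 0) / D (0, 1))) \<le> e * norm (y - x)"
    unfolding eventually_nhds_metric dist_norm .
qed

section \<open>Continuity of the least singular value\<close>

lemma norm_mult_vec_le:
  fixes M :: "'k::conj_field^'m^'n"
  shows "norm (M *v y) \<le> norm M * norm y"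
proof -
  have "norm ((M *v y) $ i) \<le> norm (M $ i) * norm y" for i
  proof -
    have "norm ((M *v y) $ i) \<le> (\<Sum>j\<in>UNIV. norm (M $ i $ j) * norm (y $ j))"
      by (simp add: matrix_vector_mult_def) (rule sum_norm_le, simp add: norm_mult)
    also have "\<dots> \<le> norm (M $ i) * norm y"
      unfolding norm_vec_def using L2_set_mult_ineq[of "\<lambda>j. norm (M $ i $ j)" "\<lambda>j. norm (y $ j)" UNIV]
      by simp
    finally show ?thesis .
  qed
  then have "L2_set (\<lambda>i. norm ((M *v y) $ i)) UNIV \<le> L2_set (\<lambda>i. norm (M $ i) * norm y) UNIV"
    by (intro L2_set_mono) auto
  then show ?thesis
    by (simp add: norm_vec_def L2_set_left_distrib)
qed

lemma norm_adjoint_mult_le: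
  fixes M :: "'k::conj_field^'m^'n"
  shows "norm (ctranspose M *v x) \<le> norm M * norm x"
proof (cases "ctranspose M *v x = 0")
  case False
  have "(norm (ctranspose M *v x))\<^sup>2 = x \<bullet> (M *v (ctranspose M *v x))"
    by (simp only: power2_norm_eq_inner inner_adjoint)
  also have "\<dots> \<le> norm x * (norm M * norm (ctranspose M *v x))"
    by (meson norm_cauchy_schwarz norm_ge_zero norm_mult_vec_le mult_left_mono order_trans)
  finally show ?thesis
    using False by (simp add: power2_eq_square algebra_simps)
qed simp

lemma ctranspose_add: "ctranspose (M + N) = ctranspose M + ctranspose N"
  by (simp add: ctranspose_def vec_eq_iff conjg_add)

lemma ctranspose_scaleR: "ctranspose (r *\<^sub>R M) = r *\<^sub>R ctranspose (M :: 'k::conj_field^'m^'n)"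
  by (simp add: ctranspose_def vec_eq_iff conjg_scaleR)

lemma scaleR_mult_vec: "(r *\<^sub>R M) *v x = r *\<^sub>R (M *v (x :: 'k::conj_field^'m))"
  by (simp add: matrix_vector_mult_def vec_eq_iff scaleR_sum_right)

lemma bounded_linear_adjoint_mult:
  "bounded_linear (\<lambda>M :: 'k::conj_field^'m^'n. ctranspose M *v x)"
  by (intro linear_conv_bounded_linear[THEN iffD1] linearI)
     (simp_all add: ctranspose_add matrix_vector_mult_add_rdistrib ctranspose_scaleR scaleR_mult_vec)

text \<open>
  Insert the minimiser for one of the matrices into the quadratic form of the other.
\<close>

lemma least_sv_sq_lipschitz:
  "\<bar>least_sv_sq A - least_sv_sq B\<bar> \<le> (norm A + norm B) * norm (A - B)"
proof -
  have *: "least_sv_sq A - least_sv_sq B \<le> (norm A + norm B) * norm (A - B)" for A B :: "'a^'b^'c"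
  proof -
    obtain x where x: "norm x = 1" "(norm (ctranspose B *v x))\<^sup>2 = least_sv_sq B"
      using least_sv_sq_attained[of B] .
    let ?a = "norm (ctranspose A *v x)" and ?b = "norm (ctranspose B *v x)"
    have "?a - ?b \<le> norm (ctranspose (A - B) *v x)"
      by (subst linear_diff[OF bounded_linear.linear[OF bounded_linear_adjoint_mult]])
         (rule norm_triangle_ineq2)
    also have "\<dots> \<le> norm (A - B)"
      using norm_adjoint_mult_le[of "A - B" x] x(1) by simp
    finally have d: "?a - ?b \<le> norm (A - B)" .
    have "least_sv_sq A - least_sv_sq B \<le> ?a\<^sup>2 - ?b\<^sup>2"
      using least_sv_sq_le[OF x(1), of A] x(2) by simp
    also have "\<dots> = (?a + ?b) * (?a - ?b)"
      by (simp add: power2_eq_square algebra_simps)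
    also have "\<dots> \<le> (?a + ?b) * norm (A - B)"
      using d by (intro mult_left_mono) auto
    also have "\<dots> \<le> (norm A + norm B) * norm (A - B)"
      using norm_adjoint_mult_le[of A x] norm_adjoint_mult_le[of B x] x(1)
      by (intro mult_right_mono) auto
    finally show ?thesis .
  qed
  show ?thesis
    using *[of A B] *[of B A] by (simp add: abs_le_iff norm_minus_commute add.commute)
qed

lemma continuous_on_least_sv_sq: "continuous_on S least_sv_sq"
proof -
  have "isCont least_sv_sq A" for A :: "'a^'b^'c"
    unfolding continuous_at_eps_delta
  proof (intro allI impI)
    fix e :: real assume e: "e > 0"
    let ?d = "min 1 (e / (2 * norm A + 2))"
    have "\<bar>least_sv_sq B - least_sv_sq A\<bar> < e" if B: "dist B A < ?d" for B
    proof -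
      have "norm B \<le> norm A + 1"
        using B norm_triangle_ineq2[of B A] by (simp add: dist_norm)
      have "\<bar>least_sv_sq B - least_sv_sq A\<bar> \<le> (norm B + norm A) * norm (B - A)"
        by (rule least_sv_sq_lipschitz)
      also have "\<dots> \<le> (2 * norm A + 2) * norm (B - A)"
        using \<open>norm B \<le> _\<close> by (intro mult_right_mono) auto
      also have "\<dots> < e"
        using B by (simp add: dist_norm field_simps add_pos_nonneg)
      finally show ?thesis .
    qed
    moreover have "?d > 0" using e by (simp add: add_nonneg_pos)
    ultimately show "\<exists>d>0. \<forall>B. dist B A < d \<longrightarrow> dist (least_sv_sq B) (least_sv_sq A) < e"
      unfolding dist_real_def by blast
  qed
  then show ?thesis by (simp add: continuous_at_imp_continuous_on)
qed

section \<open>Smoothness of the least singular value\<close>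

text \<open>
  The matrix \<open>A A\<^sup>* - s + x0 x0\<^sup>*\<close>. If the unit vector \<open>x0\<close> spans the eigenspace of a simple
  eigenvalue \<open>s\<close> of \<open>A A\<^sup>*\<close>, then the rank-one term makes the singular matrix \<open>A A\<^sup>* - s\<close>
  invertible, and it stays so for nearby \<open>A\<close> and \<open>s\<close>.
\<close>

definition bordered :: "'k::conj_field^'n \<Rightarrow> ('k^'m^'n) \<times> real \<Rightarrow> 'k^'n^'n"
  where "bordered x0 p = (\<chi> i j. gram (fst p) $ i $ j - (if i = j then of_real (snd p) else 0)
    + x0 $ i * conjg (x0 $ j))"

text \<open>
  The function \<open>((A A\<^sup>* - s + x0 x0\<^sup>*)\<^sup>-\<^sup>1 x0) \<bullet> x0\<close>, with the inverse written out by Cramer's rule, so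
  that it is visibly a rational function of the entries of \<open>A\<close>, their conjugates and \<open>s\<close>, hence smooth.
  By the matrix determinant lemma it equals \<open>1\<close>, where it makes sense, exactly when \<open>s\<close> is an
  eigenvalue of \<open>A A\<^sup>*\<close>.
\<close>

definition secular :: "'k::conj_field^'n \<Rightarrow> ('k^'m^'n) \<times> real \<Rightarrow> real"
  where "secular x0 p = (\<Sum>k\<in>UNIV.
    (det (\<chi> i j. if j = k then x0 $ i else bordered x0 p $ i $ j) * inverse (det (bordered x0 p))) \<bullet> (x0 $ k))"

lemma bordered_mult:
  "bordered x0 p *v x = gram (fst p) *v x - snd p *\<^sub>R x + (\<Sum>j\<in>UNIV. x $ j * conjg (x0 $ j)) *s x0"
proof -
  have "(\<Sum>j\<in>UNIV. (if i = j then of_real s else 0) * x $ j) = s *\<^sub>R x $ i" for i s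
  proof -
    have "(\<Sum>j\<in>UNIV. (if i = j then of_real s else 0) * x $ j) = (\<Sum>j\<in>UNIV. if i = j then of_real s * x $ j else 0)"
      by (intro sum.cong) auto
    then show ?thesis by (simp add: scaleR_conv_of_real)
  qed
  moreover have "(\<Sum>j\<in>UNIV. x0 $ i * conjg (x0 $ j) * x $ j) = (\<Sum>j\<in>UNIV. x $ j * conjg (x0 $ j)) * x0 $ i" for i
    by (simp add: sum_distrib_left mult_ac)
  ultimately show ?thesis
    by (simp add: vec_eq_iff bordered_def matrix_vector_mult_def distrib_right left_diff_distrib
        sum.distrib sum_subtractf del: mult_if_delta)
qed

lemma secular_eq:
  assumes "det (bordered x0 p) \<noteq> 0" "bordered x0 p *v x = x0"
  shows "secular x0 p = x \<bullet> x0"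
  using cramer[OF assms(1), of x x0] assms(2)
  by (simp add: secular_def inner_vec_def divide_inverse)

lemma Ck_on_bordered: "Ck_on k E V (\<lambda>p. bordered x0 p $ i $ j)"
proof -
  have lin: "bounded_linear (\<lambda>p :: ('a^'b^'c) \<times> real. fst p $ i $ l)"
    "bounded_linear (\<lambda>p :: ('a^'b^'c) \<times> real. conjg (fst p $ i $ l))" for i l
    by (intro linear_conv_bounded_linear[THEN iffD1] linearI; simp add: conjg_add conjg_scaleR)+
  have lin2: "bounded_linear (\<lambda>p :: ('a^'b^'c) \<times> real. of_real (snd p) :: 'a)"
    by (auto intro!: linear_conv_bounded_linear[THEN iffD1] linearI simp: scaleR_conv_of_real)
  have eq: "bordered x0 = (\<lambda>p. \<chi> i j. (\<Sum>l\<in>UNIV. fst p $ i $ l * conjg (fst p $ j $ l))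
      + ((- (if i = j then 1 else 0)) * of_real (snd p) + x0 $ i * conjg (x0 $ j)))"
    by (auto simp: bordered_def fun_eq_iff vec_eq_iff matrix_matrix_mult_def ctranspose_def)
  moreover have "Ck_on k E V (\<lambda>p. fst p $ i $ l)" "Ck_on k E V (\<lambda>p. conjg (fst p $ j $ l))"
    "Ck_on k E V (\<lambda>p. of_real (snd p) :: 'a)" for l
    using Ck_on_bounded_linear[OF lin(1) Ck_on_ident, of k E V i l]
      Ck_on_bounded_linear[OF lin(2) Ck_on_ident, of k E V j l]
      Ck_on_bounded_linear[OF lin2 Ck_on_ident, of k E V]
    by auto
  then have "Ck_on k E V (\<lambda>p. (\<Sum>l\<in>UNIV. fst p $ i $ l * conjg (fst p $ j $ l))
      + ((- (if i = j then 1 else 0)) * of_real (snd p) + x0 $ i * conjg (x0 $ j)))"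
    by (intro Ck_on_add Ck_on_sum Ck_on_const Ck_on_bilinear[OF bounded_bilinear_mult])
  ultimately show ?thesis unfolding eq vec_lambda_beta by blast
qed

lemma Ck_on_secular:
  assumes "\<And>p. p \<in> V \<Longrightarrow> det (bordered x0 p) \<noteq> 0"
  shows "Ck_on k E V (secular x0)"
proof -
  have "Ck_on k E V (\<lambda>p. (\<chi> i j. if j = l then x0 $ i else bordered x0 p $ i $ j) $ i $ j)" for l i j
    by (cases "j = l") (simp_all add: Ck_on_const Ck_on_bordered)
  then show ?thesis
    unfolding secular_def[abs_def] using assms
    by (intro Ck_on_sum Ck_on_bounded_linear[OF bounded_linear_inner_left]
        Ck_on_bilinear[OF bounded_bilinear_mult] Ck_on_inverse Ck_on_det Ck_on_bordered)
qed

lemma det_nz_iff_ker: "det M \<noteq> 0 \<longleftrightarrow> (\<forall>x. M *v x = 0 \<longrightarrow> x = 0)"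
  for M :: "'a::field^'n^'n"
  by (metis invertible_det_nz invertible_left_inverse matrix_left_invertible_ker)

text \<open>
  The least eigenvalue solves the implicit equation at every matrix where the bordered matrix is
  invertible, not only at the base point. An eigenvector \<open>x\<close> is mapped to a multiple
  \<open>\<kappa>\<close> of \<open>x0\<close>, with \<open>\<kappa> \<noteq> 0\<close> by invertibility, so \<open>x / \<kappa>\<close> is the solution that
  Cramer's rule computes.
\<close>

lemma secular_least_sv_sq:
  fixes A :: "'k::conj_field^'m^'n"
  assumes "det (bordered x0 (A, least_sv_sq A)) \<noteq> 0"
  shows "secular x0 (A, least_sv_sq A) = 1"
proof -
  let ?N = "bordered x0 (A, least_sv_sq A)"
  obtain x where x: "norm x = 1" "gram A *v x = least_sv_sq A *\<^sub>R x"
    using least_sv_sq_attained[of A] .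
  define \<kappa> where "\<kappa> = (\<Sum>j\<in>UNIV. x $ j * conjg (x0 $ j))"
  have N: "?N *v x = \<kappa> *s x0"
    using x by (simp add: bordered_mult \<kappa>_def)
  have "\<kappa> \<noteq> 0"
    using N x(1) assms by (auto simp: det_nz_iff_ker)
  have "?N *v (inverse \<kappa> *s x) = x0"
    using \<open>\<kappa> \<noteq> 0\<close> N by (simp add: vec.linear_scale[OF matrix_vector_mul_linear_gen] vector_smult_assoc)
  from secular_eq[OF assms this] have "secular x0 (A, least_sv_sq A) = (inverse \<kappa> *s x) \<bullet> x0" .
  also have "\<dots> = (inverse \<kappa> * \<kappa>) \<bullet> 1"
    unfolding inner_vec_def \<kappa>_def sum_distrib_left inner_sum_left
    by (intro sum.cong refl) (simp add: mult.assoc[symmetric], rule inner_conjg)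
  finally show ?thesis using \<open>\<kappa> \<noteq> 0\<close> by (simp add: dot_square_norm)
qed

lemma sum_mult_conjg_self:
  "(\<Sum>j\<in>UNIV. x $ j * conjg (x $ j)) = of_real ((norm (x :: 'k::conj_field^'n))\<^sup>2)"
proof -
  have "(norm x)\<^sup>2 = (\<Sum>j\<in>UNIV. (norm (x $ j))\<^sup>2)"
    by (simp add: power2_norm_eq_inner inner_vec_def)
  then show ?thesis by (simp add: mult_conjg_self')
qed

text \<open>
  The kernel of the bordered matrix is trivial: pairing with \<open>x0\<close> shows that the rank-one part
  vanishes on it, which leaves an eigenvector orthogonal to \<open>x0\<close>.
\<close>

lemma bordered_simple:
  fixes A :: "'k::conj_field^'m^'n"
  assumes x0: "norm x0 = 1" and simple: "\<And>z. gram A *v z = least_sv_sq A *\<^sub>R z \<Longrightarrow> \<exists>k. z = k *s x0"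
  shows "gram A *v x0 = least_sv_sq A *\<^sub>R x0" "det (bordered x0 (A, least_sv_sq A)) \<noteq> 0"
proof -
  have s: "(\<Sum>j\<in>UNIV. x0 $ j * conjg (x0 $ j)) = 1"
    using x0 by (simp add: sum_mult_conjg_self)
  obtain x where x: "norm x = 1" "gram A *v x = least_sv_sq A *\<^sub>R x"
    using least_sv_sq_attained[of A] .
  then obtain k where k: "x = k *s x0" using simple by blast
  then have "k \<noteq> 0" using x(1) by auto
  then have x0x: "x0 = inverse k *s x" by (simp add: k vector_smult_assoc)
  have "gram A *v (inverse k *s x) = least_sv_sq A *\<^sub>R (inverse k *s x)"
    unfolding vec.linear_scale[OF matrix_vector_mul_linear_gen] x(2) by (simp add: vec_eq_iff)
  then show eig: "gram A *v x0 = least_sv_sq A *\<^sub>R x0"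
    unfolding x0x[symmetric] .
  show "det (bordered x0 (A, least_sv_sq A)) \<noteq> 0"
    unfolding det_nz_iff_ker
  proof (intro allI impI)
    fix z assume z: "bordered x0 (A, least_sv_sq A) *v z = 0"
    define \<kappa> where "\<kappa> = (\<Sum>j\<in>UNIV. z $ j * conjg (x0 $ j))"
    have 0: "gram A *v z - least_sv_sq A *\<^sub>R z + \<kappa> *s x0 = 0"
      using z by (simp add: bordered_mult \<kappa>_def)
    have "(gram A *v z - least_sv_sq A *\<^sub>R z) \<bullet> y = z \<bullet> (gram A *v y - least_sv_sq A *\<^sub>R y)" for y
      by (simp add: inner_diff_left inner_diff_right) (metis inner_commute inner_gram)
    moreover have "gram A *v (\<kappa> *s x0) - least_sv_sq A *\<^sub>R (\<kappa> *s x0) = 0"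
      using eig by (simp add: vec.linear_scale[OF matrix_vector_mul_linear_gen] vec_eq_iff)
    ultimately have "(gram A *v z - least_sv_sq A *\<^sub>R z) \<bullet> (\<kappa> *s x0) = 0" by simp
    moreover have "gram A *v z - least_sv_sq A *\<^sub>R z = - (\<kappa> *s x0)"
      using 0 by (simp add: eq_neg_iff_add_eq_0)
    ultimately have "\<kappa> *s x0 = 0" by simp
    then have "\<kappa> = 0" using x0 by (metis norm_zero vec.scale_eq_0_iff zero_neq_one)
    then obtain k where k: "z = k *s x0" using 0 simple by auto
    then have "\<kappa> = k * (\<Sum>j\<in>UNIV. x0 $ j * conjg (x0 $ j))"
      by (simp add: \<kappa>_def sum_distrib_left mult.assoc)
    then show "z = 0" using s k \<open>\<kappa> = 0\<close> by simp
  qed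
qed

text \<open>
  At the base point \<open>x0\<close> is an eigenvector of the bordered matrix for every \<open>s\<close>, and the secular
  function is \<open>1 / (1 + \<mu> - s)\<close> in closed form, where \<open>\<mu>\<close> is the least eigenvalue. This is the
  nondegeneracy needed for the implicit equation.
\<close>

lemma secular_deriv_simple:
  fixes A :: "'k::conj_field^'m^'n"
  assumes x0: "norm x0 = 1" and simple: "\<And>z. gram A *v z = least_sv_sq A *\<^sub>R z \<Longrightarrow> \<exists>k. z = k *s x0"
    and D: "(secular x0 has_derivative D) (at (A, least_sv_sq A))"
    and open_nz: "open {p :: ('k^'m^'n) \<times> real. det (bordered x0 p) \<noteq> 0}"
  shows "D (0, 1) = 1"
proof -
  let ?\<mu> = "least_sv_sq A"
  have "((\<lambda>s. (A, s)) has_derivative (\<lambda>h. (0, h))) (at ?\<mu>)"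
    by (intro derivative_eq_intros) auto
  from has_derivative_compose[OF this D]
  have 1: "((\<lambda>s. secular x0 (A, s)) has_derivative (\<lambda>h. D (0, h))) (at ?\<mu>)" .
  have "\<forall>\<^sub>F s in nhds ?\<mu>. det (bordered x0 (A, s)) \<noteq> 0 \<and> s < 1 + ?\<mu>"
  proof (rule eventually_conj)
    have "continuous_on UNIV (\<lambda>s :: real. (A, s))" by (intro continuous_intros)
    then have "open ((\<lambda>s :: real. (A, s)) -` {p. det (bordered x0 p) \<noteq> 0})"
      using open_nz by (rule open_vimage[rotated])
    then show "\<forall>\<^sub>F s in nhds ?\<mu>. det (bordered x0 (A, s)) \<noteq> 0"
      using bordered_simple(2)[OF x0 simple] by (auto dest!: eventually_nhds_in_open)
    show "\<forall>\<^sub>F s in nhds ?\<mu>. s < 1 + ?\<mu>"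
      using eventually_nhds_in_open[of "{..<1 + ?\<mu>}" ?\<mu>] by simp
  qed
  then have ev: "\<forall>\<^sub>F s in nhds ?\<mu>. secular x0 (A, s) = inverse (1 + ?\<mu> - s)"
  proof eventually_elim
    case (elim s)
    have s1: "(\<Sum>j\<in>UNIV. x0 $ j * conjg (x0 $ j)) = 1"
      using x0 by (simp add: sum_mult_conjg_self)
    have "bordered x0 (A, s) *v x0 = (1 + ?\<mu> - s) *\<^sub>R x0"
      using bordered_simple(1)[OF x0 simple] by (simp add: bordered_mult s1 algebra_simps)
    then have "bordered x0 (A, s) *v (inverse (1 + ?\<mu> - s) *\<^sub>R x0) = x0"
      using elim by (simp add: mult_vec_scaleR)
    from secular_eq[OF _ this] elim x0 show ?case by (simp add: norm_eq_1)
  qed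
  have "((\<lambda>s. inverse (1 + ?\<mu> - s)) has_real_derivative 1) (at ?\<mu>)"
    by (auto intro!: derivative_eq_intros)
  then have "((\<lambda>s. secular x0 (A, s)) has_real_derivative 1) (at ?\<mu>)"
    using DERIV_cong_ev[OF refl ev refl] by blast
  then show ?thesis
    using has_derivative_unique[OF 1, of "(*) 1"] by (metis has_field_derivative_def mult_1)
qed

text \<open>
  Bootstrapping: implicit differentiation expresses the derivative of \<open>least_sv_sq\<close> by smooth functions of
  \<open>A\<close> and \<open>least_sv_sq A\<close>, so each order of differentiability yields the next one. The base case
  is continuity.
\<close>

lemma least_sv_sq_Ck2_local:
  fixes A0 :: "'k::conj_field^'m^'n"
  assumes "A0 \<in> simple_least"
  shows "\<exists>W. open W \<and> A0 \<in> W \<and> Ck_on 2 UNIV W least_sv_sq"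
proof -
  obtain x0 where x0: "norm x0 = 1" and
    simple: "\<And>z. gram A0 *v z = least_sv_sq A0 *\<^sub>R z \<Longrightarrow> \<exists>k. z = k *s x0"
    using assms unfolding simple_least_def by blast
  define \<Omega> where "\<Omega> = {p :: ('k^'m^'n) \<times> real. det (bordered x0 p) \<noteq> 0}"
  have "Ck_on 0 UNIV UNIV (\<lambda>p :: ('k^'m^'n) \<times> real. det (bordered x0 p))"
    by (intro Ck_on_det Ck_on_bordered)
  then have op: "open \<Omega>"
    unfolding \<Omega>_def by (intro open_Collect_neq) auto
  have "Ck_on (Suc 1) UNIV \<Omega> (secular x0)"
    by (rule Ck_on_secular) (simp add: \<Omega>_def)
  then obtain D where "\<And>p. p \<in> \<Omega> \<Longrightarrow> (secular x0 has_derivative D p) (at p within \<Omega>)"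
    and D2: "\<And>u. Ck_on 1 UNIV \<Omega> (\<lambda>p. D p u)"
    unfolding Ck_on.simps(2)[of 1] by blast
  then have D1: "(secular x0 has_derivative D p) (at p)" if "p \<in> \<Omega>" for p
    using that op by (metis at_within_open)
  let ?g = "\<lambda>A :: 'k^'m^'n. (A, least_sv_sq A)"
  have cg: "continuous_on UNIV ?g"
    by (intro continuous_intros continuous_on_least_sv_sq)
  define \<Omega>' where "\<Omega>' = \<Omega> \<inter> (\<lambda>p. D p (0, 1)) -` (- {0})"
  have "continuous_on \<Omega> (\<lambda>p. D p (0, 1))"
    using D2 by (rule Ck_on_imp_continuous_on)
  then have "open \<Omega>'"
    unfolding \<Omega>'_def using op by (intro continuous_open_preimage) auto
  define W where "W = ?g -` \<Omega>'"
  have "open W"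
    unfolding W_def using cg \<open>open \<Omega>'\<close> by (simp add: continuous_on_open_vimage)
  have g0: "?g A0 \<in> \<Omega>"
    using bordered_simple(2)[OF x0 simple] by (simp add: \<Omega>_def)
  have "D (?g A0) (0, 1) = 1"
    by (rule secular_deriv_simple[OF x0 simple D1[OF g0] op[unfolded \<Omega>_def]])
  then have "A0 \<in> W"
    using g0 by (simp add: W_def \<Omega>'_def)
  have nz: "D (?g A) (0, 1) \<noteq> 0" if "A \<in> W" for A
    using that by (simp add: W_def \<Omega>'_def)
  let ?d = "\<lambda>A u. - (D (?g A) (u, 0) / D (?g A) (0, 1))"
  have gW: "?g ` W \<subseteq> \<Omega>" by (auto simp: W_def \<Omega>'_def)
  have der: "(least_sv_sq has_derivative ?d A) (at A)" if A: "A \<in> W" for A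
  proof (rule has_derivative_implicit_real)
    show "(secular x0 has_derivative D (?g A)) (at (?g A))"
      using gW A by (intro D1) auto
    show "D (?g A) (0, 1) \<noteq> 0"
      by (rule nz[OF A])
    show "\<forall>\<^sub>F B in nhds A. secular x0 (?g B) = 1"
      using eventually_nhds_in_open[OF \<open>open W\<close> A]
    proof eventually_elim
      case (elim B)
      then have "?g B \<in> \<Omega>" using gW by blast
      then show ?case by (intro secular_least_sv_sq) (simp add: \<Omega>_def)
    qed
    show "\<forall>\<^sub>F B in nhds A. \<bar>least_sv_sq B - least_sv_sq A\<bar> \<le> (2 * norm A + 1) * norm (B - A)"
      using eventually_nhds_ball[of 1 A, OF zero_less_one]
    proof eventually_elim
      case (elim B)
      then have "norm B \<le> norm A + 1"
        using norm_triangle_ineq2[of B A] by (simp add: dist_norm norm_minus_commute)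
      then have "(norm B + norm A) * norm (B - A) \<le> (2 * norm A + 1) * norm (B - A)"
        by (intro mult_right_mono) auto
      then show ?case using least_sv_sq_lipschitz[of B A] by linarith
    qed
  qed
  have step: "Ck_on (Suc k) UNIV W least_sv_sq"
    if k: "Ck_on k UNIV W least_sv_sq" "\<And>u. Ck_on k UNIV \<Omega> (\<lambda>p. D p u)" for k
  proof -
    have l1: "bounded_linear (\<lambda>A :: 'k^'m^'n. (A, 0 :: real))"
      by (intro bounded_linear_Pair bounded_linear_ident bounded_linear_zero)
    have l2: "bounded_linear (\<lambda>s :: real. (0 :: 'k^'m^'n, s))"
      by (intro bounded_linear_Pair bounded_linear_ident bounded_linear_zero)
    have "Ck_on k UNIV W (\<lambda>A. (A, 0) + (0, least_sv_sq A))"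
      by (intro Ck_on_add Ck_on_bounded_linear[OF l1] Ck_on_bounded_linear[OF l2] k Ck_on_ident)
    then have g: "Ck_on k UNIV W ?g" by simp
    have "Ck_on k UNIV W (\<lambda>A. D (?g A) u)" for u
      by (rule Ck_on_compose[OF gW g k(2)])
    then have "Ck_on k UNIV W (\<lambda>A. (- 1) * (D (?g A) (u, 0) * inverse (D (?g A) (0, 1))))" for u
      by (intro Ck_on_bilinear[OF bounded_bilinear_mult] Ck_on_const Ck_on_inverse nz)
    then have d1: "Ck_on k UNIV W (\<lambda>A. ?d A u)" for u
      by (simp add: divide_inverse)
    have d2: "(least_sv_sq has_derivative ?d A) (at A within W)" if "A \<in> W" for A
      using der[OF that] by (rule has_derivative_at_withinI)
    show ?thesis
      unfolding Ck_on.simps by (intro exI[of _ ?d] conjI ballI d1 d2)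
  qed
  have D0: "Ck_on 0 UNIV \<Omega> (\<lambda>p. D p u)" for u
    using Ck_on_imp_continuous_on[OF D2] by simp
  have "Ck_on 0 UNIV W least_sv_sq"
    by (simp add: continuous_on_least_sv_sq)
  then have "Ck_on (Suc (Suc 0)) UNIV W least_sv_sq"
    using D2 by (intro step D0) auto
  then show ?thesis
    using \<open>open W\<close> \<open>A0 \<in> W\<close> unfolding numeral_2_eq_2 by (intro exI conjI)
qed

lemma Ck_on_least_sv_sq: "Ck_on 2 UNIV simple_least least_sv_sq"
  by (rule Ck_on_local) (rule least_sv_sq_Ck2_local)

text \<open>
  Since the derivative exists and \<open>|M\<^sup>* x|\<^sup>2 - least_sv_sq M\<close> has a minimum at \<open>A\<close>, the derivative is
  that of the quadratic form.
\<close>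

lemma least_sv_sq_has_derivative:
  fixes A :: "'k::conj_field^'m^'n"
  assumes A: "A \<in> simple_least" and x: "norm x = 1" "(norm (ctranspose A *v x))\<^sup>2 = least_sv_sq A"
  shows "(least_sv_sq has_derivative (\<lambda>U. 2 * ((ctranspose A *v x) \<bullet> (ctranspose U *v x)))) (at A)"
proof -
  obtain W where W: "open W" "A \<in> W" "Ck_on 2 UNIV W least_sv_sq"
    using least_sv_sq_Ck2_local[OF A] by (elim exE conjE) (rule that)
  obtain D' where "\<forall>B\<in>W. (least_sv_sq has_derivative D' B) (at B within W)"
    using W(3) unfolding numeral_2_eq_2 Ck_on.simps(2)[of "Suc 0"] by (elim exE conjE) (rule that)
  then have D: "(least_sv_sq has_derivative D' A) (at A)"
    using W(2) unfolding at_within_open[OF W(2,1), symmetric] by (rule bspec)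
  let ?q = "\<lambda>M. (ctranspose M *v x) \<bullet> (ctranspose M *v x)"
  let ?G = "\<lambda>U. 2 * ((ctranspose A *v x) \<bullet> (ctranspose U *v x))"
  have "((\<lambda>M :: 'k^'m^'n. ctranspose M *v x) has_derivative (\<lambda>U. ctranspose U *v x)) (at A)"
    by (rule bounded_linear_imp_has_derivative[OF bounded_linear_adjoint_mult])
  from has_derivative_inner[OF this this] have q: "(?q has_derivative ?G) (at A)"
    by (rule has_derivative_eq_rhs) (simp add: fun_eq_iff inner_commute)
  have d: "((\<lambda>M. ?q M - least_sv_sq M) has_derivative (\<lambda>U. ?G U - D' A U)) (at A)"
    by (rule has_derivative_diff[OF q D])
  have "?q A - least_sv_sq A \<le> ?q M - least_sv_sq M" for M
    using least_sv_sq_le[OF x(1), of M] x(2) by (simp add: power2_norm_eq_inner)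
  then have "(\<lambda>U. ?G U - D' A U) = (\<lambda>h. 0)"
    by (intro differential_zero_maxmin[OF UNIV_I open_UNIV d]) blast
  then have "D' A = ?G" by (simp add: fun_eq_iff)
  with D show ?thesis by simp
qed

section \<open>Convexity from lower support functions\<close>

text \<open>
  A function that can be touched from below at every point by a function with nonnegative second
  derivative is convex, even though it need not be differentiable itself. If it exceeded a
  chord, then adding a small parabola would still leave an interior maximum, and there the
  support function plus the parabola would have a local maximum with positive second derivative.
\<close>

lemma convex_on_real_if_lower_support:
  fixes h :: "real \<Rightarrow> real"
  assumes "is_interval I" and cont: "continuous_on I h"
    and supp: "\<And>t. t \<in> I \<Longrightarrow> \<exists>p p' p''. (\<forall>\<^sub>F s in nhds t. (p has_real_derivative p' s) (at s) \<and> p s \<le> h s) \<and>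
      p t = h t \<and> (p' has_real_derivative p'') (at t) \<and> 0 \<le> p''"
  shows "convex_on I h"
proof (rule convex_on_linorderI)
  show "convex I" using assms(1) by (simp add: is_interval_convex)
  fix r a b :: real
  assume r: "0 < r" "r < 1" and ab: "a \<in> I" "b \<in> I" "a < b"
  define c where "c = (1 - r) *\<^sub>R a + r *\<^sub>R b"
  define \<beta> where "\<beta> = (h b - h a) / (b - a)"
  define l where "l s = h a + \<beta> * (s - a)" for s
  have lab: "l a = h a" "l b = h b" using ab by (simp_all add: l_def \<beta>_def)
  have lc: "l c = (1 - r) * h a + r * h b"
  proof -
    have "c - a = r * (b - a)" by (simp add: c_def algebra_simps)
    then have "l c = h a + r * (h b - h a)" using ab by (simp add: l_def \<beta>_def)
    then show ?thesis by (simp add: algebra_simps)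
  qed
  have c: "a < c" "c < b"
  proof -
    have "c - a = r * (b - a)" "b - c = (1 - r) * (b - a)" by (simp_all add: c_def algebra_simps)
    then show "a < c" "c < b" using r ab(3) by (smt (verit) mult_pos_pos)+
  qed
  have sub: "{a..b} \<subseteq> I"
    using assms(1) ab(1,2) unfolding is_interval_1 by (meson atLeastAtMost_iff subsetI)
  show "h ((1 - r) *\<^sub>R a + r *\<^sub>R b) \<le> (1 - r) * h a + r * h b"
    unfolding c_def[symmetric] lc[symmetric]
  proof (rule ccontr)
    assume "\<not> h c \<le> l c"
    then have gap: "0 < h c - l c" by simp
    \<comment> \<open>The parabola vanishes at \<open>a\<close> and \<open>b\<close> and uses up half of the gap at \<open>c\<close>.\<close>
    define \<epsilon> where "\<epsilon> = (h c - l c) / (2 * ((c - a) * (b - c)))"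
    have \<epsilon>: "\<epsilon> > 0" using gap c by (simp add: \<epsilon>_def)
    define w where "w s = h s - l s + \<epsilon> * ((s - a) * (s - b))" for s
    have "\<epsilon> * ((c - a) * (b - c)) = (h c - l c) / 2"
      using c by (simp add: \<epsilon>_def)
    then have wc: "w c > 0"
      using gap by (simp add: w_def algebra_simps)
    have "continuous_on {a..b} w"
      unfolding w_def l_def by (intro continuous_intros continuous_on_subset[OF cont sub])
    then obtain t where t: "t \<in> {a..b}" "\<And>s. s \<in> {a..b} \<Longrightarrow> w s \<le> w t"
      using continuous_attains_sup[of "{a..b}" w] ab by auto
    have "w t > 0" using t(2)[of c] c wc by simp
    moreover have "w a = 0" "w b = 0" by (simp_all add: w_def lab)
    ultimately have tab: "a < t" "t < b" using t(1) by (auto simp: less_le)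
    obtain p p' p'' where p: "\<forall>\<^sub>F s in nhds t. (p has_real_derivative p' s) (at s) \<and> p s \<le> h s"
      "p t = h t" "(p' has_real_derivative p'') (at t)" "0 \<le> p''"
      using supp[of t] t(1) sub by blast
    define z where "z s = p s - l s + \<epsilon> * ((s - a) * (s - b))" for s
    define z' where "z' s = p' s - \<beta> + \<epsilon> * (2 * s - a - b)" for s
    have "\<forall>\<^sub>F s in nhds t. s \<in> {a<..<b}"
      using tab by (intro eventually_nhds_in_open) auto
    with p(1) have "\<forall>\<^sub>F s in nhds t. (z has_real_derivative z' s) (at s) \<and> z s \<le> z t"
    proof eventually_elim
      case (elim s)
      have "(z has_real_derivative z' s) (at s)"
        unfolding z_def z'_def l_def using elim(1)
        by (auto intro!: derivative_eq_intros simp: algebra_simps)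
      moreover have "z s \<le> w s" using elim by (simp add: z_def w_def)
      moreover have "w s \<le> w t" using elim by (intro t(2)) auto
      moreover have "w t = z t" by (simp add: z_def w_def p(2))
      ultimately show ?case by simp
    qed
    then obtain d where d: "d > 0"
      "\<And>s. dist s t < d \<Longrightarrow> (z has_real_derivative z' s) (at s) \<and> z s \<le> z t"
      unfolding eventually_nhds_metric by blast
    have "z' t = 0"
      using d by (intro DERIV_local_max[of z "z' t" t d]) (auto simp: dist_real_def abs_minus_commute)
    moreover have "(z' has_real_derivative p'' + 2 * \<epsilon>) (at t)"
      unfolding z'_def using p(3) by (auto intro!: derivative_eq_intros)
    then obtain d' where d': "d' > 0" "\<And>k. 0 < k \<Longrightarrow> k < d' \<Longrightarrow> z' t < z' (t + k)"
      using DERIV_pos_inc_right[of z' "p'' + 2 * \<epsilon>" t] p(4) \<epsilon> by auto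
    ultimately have pos: "\<And>k. 0 < k \<Longrightarrow> k < d' \<Longrightarrow> 0 < z' (t + k)" by simp
    define k where "k = min d d' / 2"
    have k: "0 < k" "k < d" "k < d'" using d(1) d'(1) by (auto simp: k_def)
    have "\<exists>\<xi>>t. \<xi> < t + k \<and> z (t + k) - z t = (t + k - t) * z' \<xi>"
      using k d(2) by (intro MVT2) (auto simp: dist_real_def)
    then obtain \<xi> where \<xi>: "t < \<xi>" "\<xi> < t + k" "z (t + k) - z t = k * z' \<xi>" by auto
    have "0 < z' \<xi>" using pos[of "\<xi> - t"] \<xi> k by simp
    then have "z t < z (t + k)" using \<xi>(3) k by (smt (verit) mult_pos_pos)
    moreover have "z (t + k) \<le> z t" using d(2)[of "t + k"] k by (simp add: dist_real_def)
    ultimately show False by simp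
  qed
qed

section \<open>The geodesic equation on horizontal vectors\<close>

lemma inner_cscale_frob: "cscale k B \<bullet> M = k \<bullet> frob M B"
  by (simp only: inner_eq_frob frob_cscale_left inner_conjg[of k] frob_conjg)

lemma cscale_adjoint: "cscale k M \<bullet> N = M \<bullet> cscale (conjg k) N"
proof -
  have "cscale k M \<bullet> N = frob N M \<bullet> k"
    unfolding inner_cscale_frob by (rule inner_commute)
  also have "\<dots> = (frob N M * conjg k) \<bullet> 1"
    by (rule inner_conjg)
  also have "\<dots> = cscale (conjg k) N \<bullet> M"
    by (simp only: inner_eq_frob[of "cscale (conjg k) N"] frob_cscale_left mult.commute)
  finally show ?thesis unfolding inner_commute[of M] .
qed

text \<open>
  The rank-one matrix \<open>x y\<^sup>*\<close>. With \<open>y = B\<^sup>* x\<close> for a minimiser \<open>x\<close> it is half the gradient of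
  \<open>least_sv_sq\<close> at \<open>B\<close>.
\<close>

definition outer :: "'k::conj_field^'n \<Rightarrow> 'k^'m \<Rightarrow> 'k^'m^'n"
  where "outer x y = (\<chi> i j. x $ i * conjg (y $ j))"

lemma inner_outer: "outer x y \<bullet> M = y \<bullet> (ctranspose M *v x)"
proof -
  have "(a * conjg b) \<bullet> c = b \<bullet> (conjg c * a)" for a b c :: 'a
    unfolding inner_commute[of b] inner_conjg[of "a * conjg b"] inner_conjg[of "conjg c * a"]
    by (simp only: mult_ac)
  then have "outer x y \<bullet> M = (\<Sum>i\<in>UNIV. \<Sum>j\<in>UNIV. y $ j \<bullet> (conjg (M $ i $ j) * x $ i))"
    by (simp add: inner_vec_def outer_def)
  also have "\<dots> = (\<Sum>j\<in>UNIV. \<Sum>i\<in>UNIV. y $ j \<bullet> (conjg (M $ i $ j) * x $ i))"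
    by (rule sum.swap)
  finally show ?thesis
    by (simp add: inner_vec_def matrix_vector_mult_def ctranspose_def inner_sum_right)
qed

lemma adjoint_outer_mult:
  assumes "norm x = 1"
  shows "ctranspose (outer x y) *v x = y"
proof -
  have "(\<Sum>i\<in>UNIV. conjg (x $ i * conjg (y $ j)) * x $ i) = y $ j" for j
  proof -
    have "(\<Sum>i\<in>UNIV. conjg (x $ i * conjg (y $ j)) * x $ i) = y $ j * (\<Sum>i\<in>UNIV. x $ i * conjg (x $ i))"
      by (simp add: conjg_mult sum_distrib_left mult_ac)
    then show ?thesis using assms by (simp only: sum_mult_conjg_self) simp
  qed
  then show ?thesis
    by (simp add: vec_eq_iff outer_def ctranspose_def matrix_vector_mult_def)
qed

lemma frob_outer_adjoint:
  "frob (outer x (ctranspose B *v x)) B = of_real ((norm (ctranspose B *v x))\<^sup>2)"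
proof -
  let ?y = "ctranspose B *v x"
  have "frob (outer x ?y) B = (\<Sum>j\<in>UNIV. \<Sum>i\<in>UNIV. x $ i * conjg (?y $ j) * conjg (B $ i $ j))"
    unfolding frob_alt outer_def by (subst sum.swap) simp
  also have "\<dots> = (\<Sum>j\<in>UNIV. (\<Sum>i\<in>UNIV. conjg (B $ i $ j) * x $ i) * conjg (?y $ j))"
    by (simp add: sum_distrib_left mult_ac)
  also have "\<dots> = (\<Sum>j\<in>UNIV. ?y $ j * conjg (?y $ j))"
    by (simp add: matrix_vector_mult_def ctranspose_def)
  finally show ?thesis by (simp only: sum_mult_conjg_self)
qed

text \<open>
  The inner product of the horizontal parts at \<open>B\<close>; multiplied by \<open>alpha2\<close>, the Fubini-Study metric is
  this form divided by \<open>least_sv_sq B\<close>, because the factors \<open>|B|\<^sup>2\<close> cancel.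
\<close>

definition hor_inner :: "'k::conj_field^'m^'n \<Rightarrow> 'k^'m^'n \<Rightarrow> 'k^'m^'n \<Rightarrow> real"
  where "hor_inner B u v = u \<bullet> v - (frob u B \<bullet> frob v B) / (norm B)\<^sup>2"

text \<open>
  The derivative of \<open>hor_inner B u v\<close> with respect to \<open>B\<close> in the direction \<open>z\<close>.
\<close>

definition hor_inner_deriv ::
    "'k::conj_field^'m^'n \<Rightarrow> 'k^'m^'n \<Rightarrow> 'k^'m^'n \<Rightarrow> 'k^'m^'n \<Rightarrow> real"
  where "hor_inner_deriv B z u v = - ((frob u z \<bullet> frob v B + frob u B \<bullet> frob v z) / (norm B)\<^sup>2)
    + (frob u B \<bullet> frob v B) * (2 * (z \<bullet> B)) / ((norm B)\<^sup>2)\<^sup>2"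

lemma hor_decomp:
  assumes "B \<noteq> 0"
  obtains b where "C = hor B C + cscale b B" "frob (hor B C) B = 0" "frob C B = (norm B)\<^sup>2 *\<^sub>R b"
proof
  let ?b = "frob C B / of_real ((norm B)\<^sup>2)"
  show "C = hor B C + cscale ?b B" by (simp add: hor_def)
  show "frob (hor B C) B = 0" using assms by (simp add: hor_def frob_diff_left frob_cscale_left frob_self)
  show "frob C B = (norm B)\<^sup>2 *\<^sub>R ?b" using assms by (simp add: scaleR_conv_of_real)
qed

lemma inner_cscale_hor_eq_0:
  assumes "frob V B = 0"
  shows "cscale a V \<bullet> cscale k B = 0"
  using assms by (simp add: inner_eq_frob frob_cscale_left frob_cscale_right)

lemma hor_inner_eq:
  assumes "B \<noteq> 0"
  shows "hor_inner B u v = hor B u \<bullet> v"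
proof -
  have "cscale (frob u B / of_real ((norm B)\<^sup>2)) B \<bullet> v = (inverse ((norm B)\<^sup>2) *\<^sub>R frob u B) \<bullet> frob v B"
    by (simp add: inner_cscale_frob scaleR_conv_of_real divide_inverse mult.commute)
  then show ?thesis
    by (simp add: hor_inner_def hor_def inner_diff_left divide_inverse mult.commute)
qed

text \<open>
  The Christoffel term of \<open>hor_inner\<close> along a velocity \<open>C = V + b B\<close> with \<open>V\<close> horizontal. All terms of
  second order in the vertical component \<open>b\<close> cancel, as they must: the form does not see a
  rescaling of the curve that depends on time.
\<close>

lemma hor_inner_christoffel:
  assumes "B \<noteq> 0" and V: "C = V + cscale b B" "frob V B = 0"
  shows "hor_inner_deriv B C C w - hor_inner_deriv B w C C / 2 =
    cscale (conjg b) V \<bullet> w - cscale b V \<bullet> w - (norm V)\<^sup>2 * (w \<bullet> B) / (norm B)\<^sup>2"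
proof -
  define n where "n = (norm B)\<^sup>2"
  have n: "n > 0" using assms(1) by (simp add: n_def)
  have BB: "frob B B = of_real n" by (simp add: n_def frob_self)
  have CB: "frob C B = n *\<^sub>R b"
    using V by (simp add: frob_add_left frob_cscale_left BB scaleR_conv_of_real)
  have VB: "cscale a V \<bullet> cscale k B = 0" for a k
    using V(2) by (rule inner_cscale_hor_eq_0)
  have nC: "(norm C)\<^sup>2 = (norm V)\<^sup>2 + (norm b)\<^sup>2 * n"
    using VB[of 1] by (simp add: V(1) power2_norm_eq_inner inner_add_left inner_add_right
        inner_commute[of "cscale b B" V] inner_cscale_cscale n_def)
  have CB': "C \<bullet> B = n * (b \<bullet> 1)"
    using inner_eq_frob[of C B] by (simp add: CB)
  have 1: "frob C C \<bullet> frob w B = (norm C)\<^sup>2 * (w \<bullet> B)"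
    by (simp add: frob_self inner_eq_frob[of w B] inner_commute[of _ "frob w B"]
        inner_commute[of "1 :: 'a"] flip: scaleR_conv_of_real) (simp add: of_real_def inner_commute)
  have 2: "b \<bullet> frob w C = cscale b V \<bullet> w + cscale (b * b) B \<bullet> w"
    by (simp add: inner_cscale_frob[symmetric] V(1) cscale_add_right cscale_cscale inner_add_left)
  have 3: "frob C w \<bullet> b = cscale (conjg b) V \<bullet> w + (norm b)\<^sup>2 * (w \<bullet> B)"
  proof -
    have "frob C w \<bullet> b = cscale b w \<bullet> C"
      unfolding inner_cscale_frob by (rule inner_commute)
    also have "\<dots> = cscale (conjg b) C \<bullet> w"
      unfolding cscale_adjoint[of b] by (rule inner_commute)
    also have "\<dots> = cscale (conjg b) V \<bullet> w + cscale (b * conjg b) B \<bullet> w"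
      by (simp add: V(1) cscale_add_right cscale_cscale inner_add_left mult.commute)
    also have "cscale (b * conjg b) B = (norm b)\<^sup>2 *\<^sub>R B"
      by (simp only: mult_conjg_self' cscale_of_real)
    finally show ?thesis by (simp add: inner_commute)
  qed
  have 4: "2 * (b \<bullet> 1) * (b \<bullet> frob w B) = cscale (b * b) B \<bullet> w + (norm b)\<^sup>2 * (w \<bullet> B)"
  proof -
    have "2 * (b \<bullet> 1) * (b \<bullet> frob w B) = (2 * (b \<bullet> 1)) *\<^sub>R cscale b B \<bullet> w"
      by (simp add: inner_cscale_frob)
    also have "(2 * (b \<bullet> 1)) *\<^sub>R cscale b B = cscale ((b + conjg b) * b) B"
      using plus_conjg_aux[of b 1] by (simp only: cscale_of_real[symmetric] cscale_cscale) simp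
    also have "\<dots> = cscale (b * b) B + (norm b)\<^sup>2 *\<^sub>R B"
      by (simp only: distrib_right cscale_add_left mult.commute[of "conjg b"] mult_conjg_self' cscale_of_real)
    finally show ?thesis by (simp add: inner_add_left inner_commute[of w B])
  qed
  \<comment> \<open>The same identity with the inner products abstracted to real variables.\<close>
  have key: "- ((c * W + n * P) / n) + n * Q * (2 * (n * \<beta>)) / n\<^sup>2 -
      (- ((n * R + n * R) / n) + n * (n * nb) * (2 * W) / n\<^sup>2) / 2 =
      - (c * W) / n - P + 2 * \<beta> * Q + R - nb * W" for c W P Q R \<beta> nb
    using n by (simp add: field_simps power2_eq_square)
  have "hor_inner_deriv B C C w - hor_inner_deriv B w C C / 2 =
    - ((norm C)\<^sup>2 * (w \<bullet> B)) / n - b \<bullet> frob w C + 2 * (b \<bullet> 1) * (b \<bullet> frob w B)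
    + frob C w \<bullet> b - (norm b)\<^sup>2 * (w \<bullet> B)"
    unfolding hor_inner_deriv_def n_def[symmetric] CB 1 CB' inner_scaleR_left inner_scaleR_right
      inner_commute[of b "frob C w"] power2_norm_eq_inner[of b]
    by (rule key)
  also have "\<dots> = cscale (conjg b) V \<bullet> w - cscale b V \<bullet> w - (norm V)\<^sup>2 * (w \<bullet> B) / n"
    unfolding 2 3 4 nC using n by (simp add: field_simps)
  finally show ?thesis by (simp add: n_def)
qed

lemma cscale_add_conjg: "cscale b M + cscale (conjg b) M = (2 * (b \<bullet> 1)) *\<^sub>R M"
proof -
  have "b + conjg b = of_real (2 * (b \<bullet> 1))"
    using plus_conjg_aux[of b 1] by simp
  then show ?thesis
    by (metis cscale_add_left cscale_of_real)
qed

text \<open>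
  The heart of the proof, at a single time. Here \<open>B\<close>, \<open>C\<close>, \<open>S\<close> are position, velocity and
  acceleration of a geodesic in the affine slice \<open>frob B A = 1\<close>, and the conclusion is that
  \<open>ln |B|\<^sup>2 - ln |B\<^sup>* x|\<^sup>2\<close> has nonnegative second derivative. The geodesic equation is tested with
  the gradient \<open>x (B\<^sup>* x)\<^sup>*\<close>, which determines the component of the acceleration
  that enters the second derivative. What remains is \<open>2 (|V|\<^sup>2 - |V\<^sup>* x|\<^sup>2) / f\<close>, where \<open>V\<close> is the
  horizontal velocity, and \<open>|V\<^sup>* x| \<le> |V|\<close>.
\<close>

lemma geodesic_second_derivative_nonneg:
  fixes A B C S :: "'k::conj_field^'m^'n" and x :: "'k^'n"
  defines "\<rho> \<equiv> \<lambda>M :: 'k^'m^'n. ctranspose M *v x"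
  defines "n \<equiv> (norm B)\<^sup>2" and "f \<equiv> (norm (\<rho> B))\<^sup>2"
  assumes x: "norm x = 1" and f: "0 < f" and BA: "frob B A = 1"
    and geo: "\<And>w. frob w A = 0 \<Longrightarrow>
      hor_inner B S w + hor_inner_deriv B C C w - hor_inner_deriv B w C C / 2
      - hor_inner B C w * (2 * (\<rho> B \<bullet> \<rho> C)) / f + hor_inner B C C * (2 * (\<rho> B \<bullet> \<rho> w)) / (2 * f) = 0"
  shows "0 \<le> 2 * (C \<bullet> C + B \<bullet> S) / n - (2 * (B \<bullet> C) / n)\<^sup>2
    - 2 * (\<rho> C \<bullet> \<rho> C + \<rho> B \<bullet> \<rho> S) / f + (2 * (\<rho> B \<bullet> \<rho> C) / f)\<^sup>2"
proof -
  have B0: "B \<noteq> 0" using BA by auto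
  have n: "n > 0" using B0 by (simp add: n_def)
  define V where "V = hor B C"
  define H where "H = hor B S"
  obtain b where V: "C = V + cscale b B" "frob V B = 0"
    unfolding V_def using hor_decomp[OF B0] by metis
  obtain e where H: "S = H + cscale e B" "frob H B = 0"
    unfolding H_def using hor_decomp[OF B0] by metis
  define G where "G = outer x (\<rho> B)"
  \<comment> \<open>The gradient \<open>G\<close> is not tangent to the slice; subtracting a vertical vector repairs this, and
    all terms with \<open>k\<close> cancel in the end.\<close>
  define k where "k = frob G A"
  define w where "w = G - cscale k B"
  have wA: "frob w A = 0"
    by (simp add: w_def frob_diff_left frob_cscale_left BA k_def)
  have G: "G \<bullet> M = \<rho> B \<bullet> \<rho> M" for M
    by (simp add: G_def \<rho>_def inner_outer)
  have GB: "frob G B = of_real f"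
    by (simp add: G_def f_def \<rho>_def frob_outer_adjoint)
  have \<rho>G: "\<rho> G = \<rho> B"
    unfolding G_def \<rho>_def by (rule adjoint_outer_mult[OF x])
  have GkB: "\<rho> B \<bullet> \<rho> (cscale a B) = f * (a \<bullet> 1)" for a
    unfolding G[symmetric] by (simp add: inner_commute[of G] inner_cscale_frob GB)
      (simp add: of_real_def inner_commute)
  have lin: "\<rho> (M + N) = \<rho> M + \<rho> N" "\<rho> (M - N) = \<rho> M - \<rho> N" for M N
    unfolding \<rho>_def
    by (rule linear_add linear_diff; rule bounded_linear.linear[OF bounded_linear_adjoint_mult])+
  have ff: "\<rho> B \<bullet> \<rho> B = f" by (simp add: f_def power2_norm_eq_inner)
  have BB: "frob B B = of_real n" by (simp add: n_def frob_self)
  have VkB: "cscale a V \<bullet> cscale c B = 0" "cscale a H \<bullet> cscale c B = 0" for a c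
    using V(2) H(2) by (simp_all add: inner_cscale_hor_eq_0)
  note VkB' = VkB[of 1, simplified]
  have kB: "cscale a B \<bullet> B = n * (a \<bullet> 1)" for a
    by (simp add: inner_cscale_frob BB) (simp add: of_real_def inner_commute)
  define D where "D = \<rho> B \<bullet> \<rho> V"
  define Db where "Db = \<rho> B \<bullet> \<rho> (cscale b V)"
  define Dc where "Dc = \<rho> B \<bullet> \<rho> (cscale (conjg b) V)"
  define DH where "DH = \<rho> B \<bullet> \<rho> H"
  define \<beta> where "\<beta> = b \<bullet> 1"
  define \<epsilon> where "\<epsilon> = e \<bullet> 1"
  define v where "v = (norm V)\<^sup>2"
  have VC: "V \<bullet> C = v"
    by (simp add: V(1) inner_add_right VkB' v_def power2_norm_eq_inner)
  have vw: "M \<bullet> w = \<rho> B \<bullet> \<rho> M - M \<bullet> cscale k B" for M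
    by (simp add: w_def inner_diff_right inner_commute[of M G] G)
  have hw: "hor_inner B C w = D" "hor_inner B S w = DH" "hor_inner B C C = v"
    by (simp_all add: hor_inner_eq[OF B0] VC vw VkB' D_def DH_def flip: V_def H_def)
  have Bw: "w \<bullet> B = f - n * (k \<bullet> 1)"
    by (simp add: w_def inner_diff_left G ff kB)
  have \<rho>w: "\<rho> B \<bullet> \<rho> w = f - f * (k \<bullet> 1)"
    by (simp add: w_def lin inner_diff_right \<rho>G ff GkB)
  have \<rho>C: "\<rho> B \<bullet> \<rho> C = D + f * \<beta>"
    by (simp add: V(1) lin inner_add_right GkB D_def \<beta>_def)
  have chr: "hor_inner_deriv B C C w - hor_inner_deriv B w C C / 2 = Dc - Db - v * (f - n * (k \<bullet> 1)) / n"
    unfolding hor_inner_christoffel[OF B0 V] vw VkB Bw by (simp add: Dc_def Db_def v_def n_def)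
  have bb: "Db + Dc = 2 * \<beta> * D"
  proof -
    have "Db + Dc = \<rho> B \<bullet> \<rho> (cscale b V + cscale (conjg b) V)"
      by (simp add: Db_def Dc_def lin inner_add_right)
    also have "\<dots> = \<rho> B \<bullet> \<rho> ((2 * \<beta>) *\<^sub>R V)"
      by (simp only: cscale_add_conjg \<beta>_def)
    also have "\<rho> ((2 * \<beta>) *\<^sub>R V) = (2 * \<beta>) *\<^sub>R \<rho> V"
      by (simp add: \<rho>_def ctranspose_scaleR scaleR_mult_vec)
    finally show ?thesis by (simp add: D_def)
  qed
  have eq: "DH + (Dc - Db - v * (f - n * (k \<bullet> 1)) / n) - D * (2 * (D + f * \<beta>)) / f
      + v * (2 * (f - f * (k \<bullet> 1))) / (2 * f) = 0"
    using geo[OF wA] chr unfolding hw \<rho>w \<rho>C by linarith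
  then have DH: "DH = v * f / n - v + Db - Dc + 2 * D\<^sup>2 / f + 2 * \<beta> * D"
    using n f by (simp add: field_simps power2_eq_square)
  have CC: "C \<bullet> C = v + (norm b)\<^sup>2 * n"
    by (simp add: V(1) inner_add_left inner_add_right VkB' inner_commute[of "cscale b B" V]
        inner_cscale_cscale v_def n_def power2_norm_eq_inner)
  have BC: "B \<bullet> C = n * \<beta>"
    using kB[of b] VkB'(1)[of 1] by (simp add: V(1) inner_add_right inner_commute[of B] \<beta>_def)
  have BS: "B \<bullet> S = n * \<epsilon>"
    using kB[of e] VkB'(2)[of 1] by (simp add: H(1) inner_add_right inner_commute[of B] \<epsilon>_def)
  have \<rho>S: "\<rho> B \<bullet> \<rho> S = DH + f * \<epsilon>"
    by (simp add: H(1) lin inner_add_right GkB DH_def \<epsilon>_def)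
  have \<rho>bB: "\<rho> (cscale a M) = conjg a *s \<rho> M" for a M
    by (simp add: \<rho>_def ctranspose_cscale_mult)
  have "\<rho> V \<bullet> \<rho> (cscale b B) = Dc"
    by (simp add: \<rho>bB Dc_def inner_vec_scale[of "conjg b"] inner_commute[of "\<rho> V"])
  moreover have "\<rho> (cscale b B) \<bullet> \<rho> (cscale b B) = (norm b)\<^sup>2 * f"
    by (simp add: \<rho>bB norm_vec_scale norm_conjg power_mult_distrib f_def flip: power2_norm_eq_inner)
  ultimately have \<rho>CC: "\<rho> C \<bullet> \<rho> C = \<rho> V \<bullet> \<rho> V + 2 * Dc + (norm b)\<^sup>2 * f"
    by (simp add: V(1) lin inner_add_left inner_add_right inner_commute[of "\<rho> (cscale b B)" "\<rho> V"])
  have "\<rho> V \<bullet> \<rho> V \<le> v"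
    using norm_adjoint_mult_le[of V x] x
    by (simp add: \<rho>_def v_def power_mono flip: power2_norm_eq_inner)
  then have "0 \<le> 2 * (v - \<rho> V \<bullet> \<rho> V) / f" using f by simp
  also have "2 * (v - \<rho> V \<bullet> \<rho> V) / f = 2 * (v / f) - 2 * ((\<rho> V \<bullet> \<rho> V) / f)"
    by (simp add: diff_divide_distrib)
  also have "\<dots> = 2 * (C \<bullet> C + B \<bullet> S) / n - (2 * (B \<bullet> C) / n)\<^sup>2
    - 2 * (\<rho> C \<bullet> \<rho> C + \<rho> B \<bullet> \<rho> S) / f + (2 * (\<rho> B \<bullet> \<rho> C) / f)\<^sup>2"
  proof -
    have 1: "2 * (v + (norm b)\<^sup>2 * n + n * \<epsilon>) / n = 2 * (v / n) + 2 * (norm b)\<^sup>2 + 2 * \<epsilon>"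
      using n by (simp add: field_simps)
    have 2: "(2 * (n * \<beta>) / n)\<^sup>2 = 4 * \<beta>\<^sup>2"
      using n by simp
    have 3: "2 * (r + 2 * Dc + (norm b)\<^sup>2 * f + (DH + f * \<epsilon>)) / f =
        2 * (r / f) + 4 * (Dc / f) + 2 * (norm b)\<^sup>2 + 2 * (DH / f) + 2 * \<epsilon>" for r
      using f by (simp add: field_simps)
    have 4: "(2 * (D + f * \<beta>) / f)\<^sup>2 = 4 * (D / f)\<^sup>2 + 8 * (\<beta> * D / f) + 4 * \<beta>\<^sup>2"
      using f by (simp add: field_simps power2_eq_square)
    have 5: "DH / f = v / n - v / f + Db / f - Dc / f + 2 * (D / f)\<^sup>2 + 2 * (\<beta> * D / f)"
      using f n unfolding DH by (simp add: field_simps power2_eq_square)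
    have 6: "Db / f + Dc / f = 2 * (\<beta> * D / f)"
      using bb by (simp flip: add_divide_distrib)
    have 7: "2 * vf - 2 * r = 2 * vn + 2 * bn + 2 * en - 4 * bt -
          (2 * r + 4 * dc + 2 * bn + 2 * q + 2 * en) + (4 * dd + 8 * bd + 4 * bt)"
      if "q = vn - vf + db - dc + 2 * dd + 2 * bd" "db + dc = 2 * bd"
      for q vn vf db dc dd bd r bn en bt :: real
      using that by linarith
    show ?thesis
      unfolding CC BC BS \<rho>S \<rho>C \<rho>CC 1 2 3 4 by (rule 7[OF 5 6])
  qed
  finally show ?thesis .
qed

section \<open>Self-convexity\<close>

abbreviation conformal_proj_chart :: "('k::conj_field^'m^'n) set set \<Rightarrow> 'k^'m^'n \<Rightarrow> (('k^'m^'n) set, 'k^'m^'n) rchart"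
  where "conformal_proj_chart U A \<equiv> conformal_chart alpha2 (restrict_chart U (proj_chart A))"

lemma conformal_metric_eq:
  fixes A :: "'k::conj_field^'m^'n"
  assumes A: "norm A = 1" and X: "frob X A = 0" and u: "frob u A = 0" and v: "frob v A = 0"
  shows "rc_metric (conformal_proj_chart U A) X u v = hor_inner (A + X) u v / least_sv_sq (A + X)"
proof -
  let ?B = "A + X"
  have "frob ?B A = 1" using A X by (simp add: frob_add_left frob_self)
  then have B: "?B \<noteq> 0" by auto
  have "frob (hor ?B u) ?B = 0"
    using B by (simp add: hor_def frob_diff_left frob_cscale_left frob_self)
  from inner_cscale_hor_eq_0[OF this, of 1]
  have "hor ?B u \<bullet> hor ?B v = hor_inner ?B u v"
    by (simp add: hor_inner_eq[OF B] hor_def[of ?B v] inner_diff_right)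
  moreover have "rc_metric (conformal_proj_chart U A) X u v = alpha2 (proj ?B) * proj_metric A X u v"
    by (simp add: conformal_chart_def restrict_chart_def proj_chart_def)
  ultimately show ?thesis
    using B by (simp add: alpha2_proj proj_metric_eq[OF A X u v])
qed

lemma hor_inner_has_real_derivative:
  fixes B :: "'k::conj_field^'m^'n"
  assumes "B \<noteq> 0"
  shows "((\<lambda>t. hor_inner (B + t *\<^sub>R z) u v) has_real_derivative hor_inner_deriv B z u v) (at 0)"
proof -
  define p q r where "p = frob u B \<bullet> frob v B"
    and "q = frob u z \<bullet> frob v B + frob u B \<bullet> frob v z" and "r = frob u z \<bullet> frob v z"
  define n where "n = (norm B)\<^sup>2"
  have n: "n \<noteq> 0" using assms by (simp add: n_def)
  have eq: "hor_inner (B + t *\<^sub>R z) u v =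
      u \<bullet> v - (p + t * q + t\<^sup>2 * r) / (n + t * (2 * (z \<bullet> B)) + t\<^sup>2 * (z \<bullet> z))" for t
  proof -
    have 1: "frob u (B + t *\<^sub>R z) \<bullet> frob v (B + t *\<^sub>R z) = p + t * q + t\<^sup>2 * r"
      unfolding frob_add_right frob_scaleR_right inner_add_left inner_add_right inner_scaleR_left
        inner_scaleR_right p_def q_def r_def
      by (simp add: algebra_simps power2_eq_square)
    have 2: "(norm (B + t *\<^sub>R z))\<^sup>2 = n + t * (2 * (z \<bullet> B)) + t\<^sup>2 * (z \<bullet> z)"
      unfolding power2_norm_eq_inner n_def inner_add_left inner_add_right inner_scaleR_left
        inner_scaleR_right inner_commute[of B z]
      by (simp add: algebra_simps power2_eq_square)
    show ?thesis unfolding hor_inner_def 1 2 ..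
  qed
  have "((\<lambda>t. u \<bullet> v - (p + t * q + t\<^sup>2 * r) / (n + t * (2 * (z \<bullet> B)) + t\<^sup>2 * (z \<bullet> z)))
      has_real_derivative (- ((q * n - p * (2 * (z \<bullet> B))) / (n * n)))) (at 0)"
    using n by (auto intro!: derivative_eq_intros)
  moreover have "- ((q * n - p * (2 * (z \<bullet> B))) / (n * n)) = hor_inner_deriv B z u v"
    unfolding hor_inner_deriv_def n_def[symmetric] p_def[symmetric] q_def[symmetric]
    using n by (simp add: field_simps power2_eq_square)
  ultimately show ?thesis unfolding eq by simp
qed

lemma least_sv_sq_has_real_derivative_line:
  fixes B :: "'k::conj_field^'m^'n"
  assumes "B \<in> simple_least" and "norm x = 1" "(norm (ctranspose B *v x))\<^sup>2 = least_sv_sq B"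
  shows "((\<lambda>t. least_sv_sq (B + t *\<^sub>R z)) has_real_derivative
    2 * ((ctranspose B *v x) \<bullet> (ctranspose z *v x))) (at 0)"
proof -
  have "((\<lambda>t. B + t *\<^sub>R z) has_derivative (\<lambda>t. t *\<^sub>R z)) (at 0)"
    by (auto intro!: derivative_eq_intros)
  moreover have "(least_sv_sq has_derivative (\<lambda>U. 2 * ((ctranspose B *v x) \<bullet> (ctranspose U *v x)))) (at (B + 0 *\<^sub>R z))"
    using least_sv_sq_has_derivative[OF assms] by simp
  ultimately have "((\<lambda>t. least_sv_sq (B + t *\<^sub>R z)) has_derivative
      (\<lambda>t. 2 * ((ctranspose B *v x) \<bullet> (ctranspose (t *\<^sub>R z) *v x)))) (at 0)"
    by (rule has_derivative_compose)
  then show ?thesis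
    unfolding has_field_derivative_def
    by (rule has_derivative_eq_rhs) (simp add: fun_eq_iff ctranspose_scaleR scaleR_mult_vec)
qed

lemma metric_deriv_eq:
  fixes A :: "'k::conj_field^'m^'n"
  assumes A: "norm A = 1" and X: "frob X A = 0"
    and zuv: "frob z A = 0" "frob u A = 0" "frob v A = 0"
    and B: "A + X \<in> simple_least"
    and x: "norm x = 1" "(norm (ctranspose (A + X) *v x))\<^sup>2 = least_sv_sq (A + X)"
  shows "metric_deriv (conformal_proj_chart U A) X z u v =
    hor_inner_deriv (A + X) z u v / least_sv_sq (A + X)
    - hor_inner (A + X) u v * (2 * ((ctranspose (A + X) *v x) \<bullet> (ctranspose z *v x))) / (least_sv_sq (A + X))\<^sup>2"
proof -
  let ?B = "A + X"
  let ?d = "2 * ((ctranspose ?B *v x) \<bullet> (ctranspose z *v x))"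
  have f: "0 < least_sv_sq ?B" using B by (simp add: simple_least_def)
  have "frob ?B A = 1" using A X by (simp add: frob_add_left frob_self)
  then have B0: "?B \<noteq> 0" by auto
  have eq: "rc_metric (conformal_proj_chart U A) (X + t *\<^sub>R z) u v =
      hor_inner (?B + t *\<^sub>R z) u v / least_sv_sq (?B + t *\<^sub>R z)" for t
    using conformal_metric_eq[OF A, of "X + t *\<^sub>R z" u v U] X zuv
    by (simp add: frob_add_left frob_scaleR_left add.assoc)
  have "((\<lambda>t. hor_inner (?B + t *\<^sub>R z) u v / least_sv_sq (?B + t *\<^sub>R z)) has_real_derivative
      (hor_inner_deriv ?B z u v * least_sv_sq (?B + 0 *\<^sub>R z) - hor_inner (?B + 0 *\<^sub>R z) u v * ?d) /
        (least_sv_sq (?B + 0 *\<^sub>R z) * least_sv_sq (?B + 0 *\<^sub>R z))) (at 0)"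
    by (rule DERIV_divide[OF hor_inner_has_real_derivative[OF B0] least_sv_sq_has_real_derivative_line[OF B x]])
       (use f in simp)
  then have "metric_deriv (conformal_proj_chart U A) X z u v =
      (hor_inner_deriv ?B z u v * least_sv_sq ?B - hor_inner ?B u v * ?d) / (least_sv_sq ?B * least_sv_sq ?B)"
    unfolding metric_deriv_def eq by (simp add: DERIV_imp_deriv)
  also have "\<dots> = hor_inner_deriv ?B z u v / least_sv_sq ?B - hor_inner ?B u v * ?d / (least_sv_sq ?B)\<^sup>2"
    using f by (simp add: diff_divide_distrib power2_eq_square)
  finally show ?thesis .
qed

lemma proj_GL_simple_imp_simple_least:
  assumes "proj B \<in> proj ` GL_simple"
  shows "B \<in> simple_least"
proof -
  from assms obtain G where G: "proj B = proj G" "G \<in> GL_simple"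
    by (rule imageE)
  from G(1) obtain k where "k \<noteq> 0" "B = cscale k G"
    unfolding proj_eq_iff by (elim exE conjE) (rule that)
  with simple_least_cscale[OF _ subsetD[OF GL_simple_subset_simple_least G(2)]] show ?thesis
    by simp
qed

lemma DERIV_inner:
  fixes F H :: "real \<Rightarrow> 'z::real_inner"
  assumes "(F has_vector_derivative F') (at s)" "(H has_vector_derivative H') (at s)"
  shows "((\<lambda>s. F s \<bullet> H s) has_real_derivative F s \<bullet> H' + F' \<bullet> H s) (at s)"
  using bounded_bilinear.has_vector_derivative[OF bounded_bilinear_inner assms]
  by (simp add: has_real_derivative_iff_has_vector_derivative)

lemma DERIV_inner_quotient:
  fixes F H :: "real \<Rightarrow> 'z::real_inner"
  assumes F: "(F has_vector_derivative H t) (at t)" and H: "(H has_vector_derivative H') (at t)"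
    and nz: "0 < F t \<bullet> F t"
  shows "((\<lambda>s. 2 * (F s \<bullet> H s) / (F s \<bullet> F s)) has_real_derivative
    2 * (H t \<bullet> H t + F t \<bullet> H') / (F t \<bullet> F t) - (2 * (F t \<bullet> H t) / (F t \<bullet> F t))\<^sup>2) (at t)"
proof -
  have "((\<lambda>s. 2 * (F s \<bullet> H s) / (F s \<bullet> F s)) has_real_derivative
      (2 * (F t \<bullet> H' + H t \<bullet> H t) * (F t \<bullet> F t) - 2 * (F t \<bullet> H t) * (F t \<bullet> H t + H t \<bullet> F t))
        / ((F t \<bullet> F t) * (F t \<bullet> F t))) (at t)"
    using nz by (intro DERIV_divide DERIV_cmult DERIV_inner F H) auto
  moreover have "(2 * (F t \<bullet> H' + H t \<bullet> H t) * (F t \<bullet> F t) - 2 * (F t \<bullet> H t) * (F t \<bullet> H t + H t \<bullet> F t))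
        / ((F t \<bullet> F t) * (F t \<bullet> F t))
      = 2 * (H t \<bullet> H t + F t \<bullet> H') / (F t \<bullet> F t) - (2 * (F t \<bullet> H t) / (F t \<bullet> F t))\<^sup>2"
  proof -
    have "(2 * (q + r) * n - 2 * p * (p + p)) / (n * n) = 2 * (r + q) / n - (2 * p / n)\<^sup>2"
      if "0 < n" for p q r n :: real
      using that by (simp add: field_simps power2_eq_square)
    from this[OF nz] show ?thesis unfolding inner_commute[of "H t" "F t"] .
  qed
  ultimately show ?thesis by simp
qed

text \<open>
  For a geodesic \<open>\<gamma>\<close> represented by \<open>B s\<close>, freeze the minimiser \<open>x\<close> of the Rayleigh quotient at
  time \<open>t\<close>: replacing \<open>least_sv_sq (B s)\<close> by the larger \<open>|(B s)\<^sup>* x|\<^sup>2\<close> gives a lower support of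
  \<open>ln \<circ> alpha2 \<circ> \<gamma>\<close> at \<open>t\<close> that is smooth enough to be differentiated twice.
\<close>

lemma ln_alpha2_lower_support:
  fixes c :: "real \<Rightarrow> 'k::conj_field^'m^'n"
  assumes A: "norm A = 1" and J: "open J" "t \<in> J"
    and geo: "geodesic_in_chart (conformal_proj_chart (proj ` GL_simple) A) J c"
    and \<gamma>: "\<forall>s\<in>J. \<gamma> s = proj (A + c s)"
  shows "isCont (\<lambda>s. ln (alpha2 (\<gamma> s))) t"
    and "\<exists>p p' p''. (\<forall>\<^sub>F s in nhds t. (p has_real_derivative p' s) (at s) \<and> p s \<le> ln (alpha2 (\<gamma> s))) \<and>
      p t = ln (alpha2 (\<gamma> t)) \<and> (p' has_real_derivative p'') (at t) \<and> 0 \<le> p''"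
proof -
  let ?\<xi> = "conformal_proj_chart (proj ` GL_simple) A"
  define B where "B s = A + c s" for s
  from geo obtain c' c'' where g: "\<forall>t\<in>J. c t \<in> rc_dom ?\<xi> \<and>
      (c has_vector_derivative c' t) (at t) \<and> (c' has_vector_derivative c'' t) (at t) \<and>
      (\<forall>w\<in>rc_model ?\<xi>. rc_metric ?\<xi> (c t) (c'' t) w + christoffel ?\<xi> (c t) (c' t) (c' t) w = 0)"
    unfolding geodesic_in_chart_def by (elim exE) (rule that)
  have cE: "frob (c s) A = 0" and Bs: "B s \<in> simple_least" if "s \<in> J" for s
  proof -
    have "c s \<in> rc_dom ?\<xi>" using bspec[OF g that] by (rule conjunct1)
    then have "frob (c s) A = 0" "proj (B s) \<in> proj ` GL_simple"
      by (simp_all add: conformal_chart_def restrict_chart_def proj_chart_def B_def)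
    then show "frob (c s) A = 0" "B s \<in> simple_least"
      by (simp_all only: proj_GL_simple_imp_simple_least)
  qed
  have d1: "(c has_vector_derivative c' s) (at s)" and d2: "(c' has_vector_derivative c'' s) (at s)"
    if "s \<in> J" for s
    by (rule bspec[OF g that, THEN conjunct2, THEN conjunct1]
        bspec[OF g that, THEN conjunct2, THEN conjunct2, THEN conjunct1])+
  have geq: "rc_metric ?\<xi> (c t) (c'' t) w + christoffel ?\<xi> (c t) (c' t) (c' t) w = 0" if "frob w A = 0" for w
  proof -
    have "w \<in> rc_model ?\<xi>"
      using that by (simp add: conformal_chart_def restrict_chart_def proj_chart_def)
    then show ?thesis
      by (rule bspec[OF bspec[OF g J(2), THEN conjunct2, THEN conjunct2, THEN conjunct2]])
  qed
  have bl: "bounded_linear (\<lambda>M. frob M A)"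
    by (rule bounded_bilinear.bounded_linear_left[OF bilinear_frob])
  have tangent: "frob (D s) A = 0"
    if h: "\<And>s. s \<in> J \<Longrightarrow> frob (h s) A = 0" "\<And>s. s \<in> J \<Longrightarrow> (h has_vector_derivative D s) (at s)" and s: "s \<in> J"
    for h D :: "real \<Rightarrow> 'k^'m^'n" and s
  proof -
    have "((\<lambda>s. frob (h s) A) has_vector_derivative frob (D s) A) (at s)"
      using h(2)[OF s] by (rule bounded_linear.has_vector_derivative[OF bl])
    moreover have "((\<lambda>s. frob (h s) A) has_vector_derivative 0) (at s)"
      by (rule has_vector_derivative_transform_within_open[OF has_vector_derivative_const[of 0] J(1) s])
         (simp add: h(1))
    ultimately show ?thesis by (rule vector_derivative_unique_at)
  qed
  have c'E: "frob (c' s) A = 0" if "s \<in> J" for s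
    using cE d1 that by (rule tangent)
  have c''E: "frob (c'' s) A = 0" if "s \<in> J" for s
    using c'E d2 that by (rule tangent)
  obtain x where x: "norm x = 1" "(norm (ctranspose (B t) *v x))\<^sup>2 = least_sv_sq (B t)"
    using least_sv_sq_attained[of "B t"] by metis
  define \<rho> where "\<rho> M = ctranspose M *v x" for M :: "'k^'m^'n"
  have bl\<rho>: "bounded_linear \<rho>"
    unfolding \<rho>_def by (rule bounded_linear_adjoint_mult)
  have pos: "0 < least_sv_sq (B s)" if "s \<in> J" for s
    using Bs[OF that] by (simp add: simple_least_def)
  have B0: "B s \<noteq> 0" if "s \<in> J" for s
  proof -
    have "frob (B s) A = 1" using A cE[OF that] by (simp add: B_def frob_add_left frob_self)
    then show ?thesis by auto
  qed
  have le: "least_sv_sq M \<le> \<rho> M \<bullet> \<rho> M" for M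
    using least_sv_sq_le[OF x(1), of M] by (simp add: \<rho>_def power2_norm_eq_inner)
  have eqt: "\<rho> (B t) \<bullet> \<rho> (B t) = least_sv_sq (B t)"
    using x(2) by (simp add: \<rho>_def power2_norm_eq_inner)
  have BB: "0 < B s \<bullet> B s" if "s \<in> J" for s
    using B0[OF that] by simp
  have \<rho>\<rho>: "0 < \<rho> (B s) \<bullet> \<rho> (B s)" if "s \<in> J" for s
    by (rule less_le_trans[OF pos[OF that] le])
  have al: "ln (alpha2 (\<gamma> s)) = ln (B s \<bullet> B s) - ln (least_sv_sq (B s))" if "s \<in> J" for s
    using \<gamma> that pos[OF that] BB[OF that]
    by (simp add: alpha2_proj B_def[symmetric] power2_norm_eq_inner ln_div)
  have dB: "(B has_vector_derivative c' s) (at s)" if "s \<in> J" for s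
    unfolding B_def using d1[OF that] by (auto intro!: derivative_eq_intros)
  have d\<rho>B: "((\<lambda>s. \<rho> (B s)) has_vector_derivative \<rho> (c' s)) (at s)" if "s \<in> J" for s
    by (rule bounded_linear.has_vector_derivative[OF bl\<rho> dB[OF that]])
  have d\<rho>c: "((\<lambda>s. \<rho> (c' s)) has_vector_derivative \<rho> (c'' s)) (at s)" if "s \<in> J" for s
    by (rule bounded_linear.has_vector_derivative[OF bl\<rho> d2[OF that]])
  have nhJ: "\<forall>\<^sub>F s in nhds t. s \<in> J"
    using J by (rule eventually_nhds_in_open)
  show "isCont (\<lambda>s. ln (alpha2 (\<gamma> s))) t"
  proof -
    have B: "isCont B t" using has_vector_derivative_continuous[OF dB[OF J(2)]] .
    have "isCont least_sv_sq (B t)"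
      using continuous_on_least_sv_sq[of "UNIV :: ('k^'m^'n) set"] by (simp add: continuous_on_eq_continuous_at)
    from isCont_o2[OF B this] have "isCont (\<lambda>s. ln (B s \<bullet> B s) - ln (least_sv_sq (B s))) t"
      using BB[OF J(2)] pos[OF J(2)]
      by (intro continuous_diff isCont_ln' continuous_inner B) simp_all
    then show ?thesis
    proof (rule isCont_cong[THEN iffD2, rotated])
      show "\<forall>\<^sub>F s in nhds t. ln (alpha2 (\<gamma> s)) = ln (B s \<bullet> B s) - ln (least_sv_sq (B s))"
        using nhJ by eventually_elim (rule al)
    qed
  qed
  define p where "p s = ln (B s \<bullet> B s) - ln (\<rho> (B s) \<bullet> \<rho> (B s))" for s
  define p' where "p' s = 2 * (B s \<bullet> c' s) / (B s \<bullet> B s) - 2 * (\<rho> (B s) \<bullet> \<rho> (c' s)) / (\<rho> (B s) \<bullet> \<rho> (B s))" for s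
  have dp: "(p has_real_derivative p' s) (at s)" if "s \<in> J" for s
    unfolding p_def p'_def using BB[OF that] \<rho>\<rho>[OF that]
    by (auto intro!: derivative_eq_intros DERIV_inner dB d\<rho>B that simp: inner_commute divide_inverse)
  have dp': "(p' has_real_derivative
      2 * (c' t \<bullet> c' t + B t \<bullet> c'' t) / (B t \<bullet> B t) - (2 * (B t \<bullet> c' t) / (B t \<bullet> B t))\<^sup>2
      - 2 * (\<rho> (c' t) \<bullet> \<rho> (c' t) + \<rho> (B t) \<bullet> \<rho> (c'' t)) / (\<rho> (B t) \<bullet> \<rho> (B t))
      + (2 * (\<rho> (B t) \<bullet> \<rho> (c' t)) / (\<rho> (B t) \<bullet> \<rho> (B t)))\<^sup>2) (at t)"
  proof -
    have "(p' has_real_derivative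
        (2 * (c' t \<bullet> c' t + B t \<bullet> c'' t) / (B t \<bullet> B t) - (2 * (B t \<bullet> c' t) / (B t \<bullet> B t))\<^sup>2)
        - (2 * (\<rho> (c' t) \<bullet> \<rho> (c' t) + \<rho> (B t) \<bullet> \<rho> (c'' t)) / (\<rho> (B t) \<bullet> \<rho> (B t))
          - (2 * (\<rho> (B t) \<bullet> \<rho> (c' t)) / (\<rho> (B t) \<bullet> \<rho> (B t)))\<^sup>2)) (at t)"
      unfolding p'_def
      by (intro DERIV_diff DERIV_inner_quotient dB d2 d\<rho>B d\<rho>c BB \<rho>\<rho> J(2))
    then show ?thesis by (rule DERIV_cong) linarith
  qed
  have "0 \<le> 2 * (c' t \<bullet> c' t + B t \<bullet> c'' t) / (norm (B t))\<^sup>2 - (2 * (B t \<bullet> c' t) / (norm (B t))\<^sup>2)\<^sup>2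
      - 2 * (\<rho> (c' t) \<bullet> \<rho> (c' t) + \<rho> (B t) \<bullet> \<rho> (c'' t)) / (norm (\<rho> (B t)))\<^sup>2
      + (2 * (\<rho> (B t) \<bullet> \<rho> (c' t)) / (norm (\<rho> (B t)))\<^sup>2)\<^sup>2"
    unfolding \<rho>_def
  proof (rule geodesic_second_derivative_nonneg[OF x(1)])
    show "0 < (norm (ctranspose (B t) *v x))\<^sup>2" using pos[OF J(2)] x(2) by simp
    show "frob (B t) A = 1" using A cE[OF J(2)] by (simp add: B_def frob_add_left frob_self)
    fix w assume w: "frob w A = 0"
    define f where "f = least_sv_sq (B t)"
    have f: "f > 0" unfolding f_def by (rule pos[OF J(2)])
    define \<delta> where "\<delta> M = 2 * (\<rho> (B t) \<bullet> \<rho> M)" for M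
    note E = cE[OF J(2)] c'E[OF J(2)] c''E[OF J(2)]
    have md: "metric_deriv ?\<xi> (c t) z u v = hor_inner_deriv (B t) z u v / f - hor_inner (B t) u v * \<delta> z / f\<^sup>2"
      if "frob z A = 0" "frob u A = 0" "frob v A = 0" for z u v
      using metric_deriv_eq[OF A E(1) that Bs[OF J(2), unfolded B_def] x(1) x(2)[unfolded B_def]]
      by (simp add: B_def f_def \<delta>_def \<rho>_def)
    \<comment> \<open>The geodesic equation of the chart is the tested equation divided by \<open>f\<close>.\<close>
    have scale: "a + d - e / 2 - p * u / f + q * v / (2 * f) =
        f * (a / f + ((d / f - p * u / f\<^sup>2) + (d / f - p * u / f\<^sup>2) - (e / f - q * v / f\<^sup>2)) / 2)"
      for a d e p u q v :: real
      using f by (simp add: field_simps power2_eq_square)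
    have "hor_inner (B t) (c'' t) w / f + ((hor_inner_deriv (B t) (c' t) (c' t) w / f - hor_inner (B t) (c' t) w * \<delta> (c' t) / f\<^sup>2)
       + (hor_inner_deriv (B t) (c' t) (c' t) w / f - hor_inner (B t) (c' t) w * \<delta> (c' t) / f\<^sup>2)
       - (hor_inner_deriv (B t) w (c' t) (c' t) / f - hor_inner (B t) (c' t) (c' t) * \<delta> w / f\<^sup>2)) / 2 = 0"
      using geq[OF w] conformal_metric_eq[OF A E(1) E(3) w]
      unfolding christoffel_def md[OF E(2) E(2) w] md[OF w E(2) E(2)] B_def[symmetric] f_def[symmetric]
      by simp
    then have "hor_inner (B t) (c'' t) w + hor_inner_deriv (B t) (c' t) (c' t) w - hor_inner_deriv (B t) w (c' t) (c' t) / 2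
       - hor_inner (B t) (c' t) w * \<delta> (c' t) / f + hor_inner (B t) (c' t) (c' t) * \<delta> w / (2 * f) = 0"
      unfolding scale by (simp only: mult_zero_right)
    then show "hor_inner (B t) (c'' t) w + hor_inner_deriv (B t) (c' t) (c' t) w - hor_inner_deriv (B t) w (c' t) (c' t) / 2
       - hor_inner (B t) (c' t) w * (2 * ((ctranspose (B t) *v x) \<bullet> (ctranspose (c' t) *v x))) / (norm (ctranspose (B t) *v x))\<^sup>2
       + hor_inner (B t) (c' t) (c' t) * (2 * ((ctranspose (B t) *v x) \<bullet> (ctranspose w *v x))) / (2 * (norm (ctranspose (B t) *v x))\<^sup>2) = 0"
      unfolding x(2) f_def \<delta>_def \<rho>_def .
  qed
  then have nonneg: "0 \<le> 2 * (c' t \<bullet> c' t + B t \<bullet> c'' t) / (B t \<bullet> B t) - (2 * (B t \<bullet> c' t) / (B t \<bullet> B t))\<^sup>2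
      - 2 * (\<rho> (c' t) \<bullet> \<rho> (c' t) + \<rho> (B t) \<bullet> \<rho> (c'' t)) / (\<rho> (B t) \<bullet> \<rho> (B t))
      + (2 * (\<rho> (B t) \<bullet> \<rho> (c' t)) / (\<rho> (B t) \<bullet> \<rho> (B t)))\<^sup>2"
    unfolding power2_norm_eq_inner .
  have "\<forall>\<^sub>F s in nhds t. (p has_real_derivative p' s) (at s) \<and> p s \<le> ln (alpha2 (\<gamma> s))"
    using nhJ
  proof eventually_elim
    case (elim s)
    show ?case
      using dp[OF elim] al[OF elim] ln_le_cancel_iff[OF pos[OF elim] \<rho>\<rho>[OF elim], THEN iffD2, OF le]
      by (simp add: p_def)
  qed
  moreover have "p t = ln (alpha2 (\<gamma> t))"
    using al[OF J(2)] eqt by (simp add: p_def)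
  ultimately show "\<exists>p p' p''. (\<forall>\<^sub>F s in nhds t. (p has_real_derivative p' s) (at s) \<and> p s \<le> ln (alpha2 (\<gamma> s))) \<and>
      p t = ln (alpha2 (\<gamma> t)) \<and> (p' has_real_derivative p'') (at t) \<and> 0 \<le> p''"
    using dp' nonneg by (intro exI conjI)
qed

lemma self_convex_alpha2:
  "self_convex PGL_atlas (alpha2 :: ('k::conj_field^'m^'n) set \<Rightarrow> real)"
  unfolding self_convex_def
proof (intro conjI ballI allI impI)
  fix \<xi> :: "(('k^'m^'n) set, 'k^'m^'n) rchart" assume "\<xi> \<in> PGL_atlas"
  then obtain A where A: "norm A = 1" and \<xi>: "\<xi> = restrict_chart (proj ` GL_simple) (proj_chart A)"
    by (auto simp: PGL_atlas_def proj_atlas_def)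
  let ?V = "rc_dom \<xi>"
  have par: "rc_param \<xi> X = proj (A + X)" for X
    by (simp add: \<xi> restrict_chart_def proj_chart_def)
  have V: "A + X \<in> simple_least" "A + X \<noteq> 0" if "X \<in> ?V" for X
  proof -
    have X: "frob X A = 0" "proj (A + X) \<in> proj ` GL_simple"
      using that by (simp_all add: \<xi> restrict_chart_def proj_chart_def)
    then show "A + X \<in> simple_least" by (intro proj_GL_simple_imp_simple_least)
    have "frob (A + X) A = 1" using X(1) A by (simp add: frob_add_left frob_self)
    then show "A + X \<noteq> 0" by auto
  qed
  have pos: "0 < least_sv_sq (A + X)" if "X \<in> ?V" for X
    using V(1)[OF that] by (simp add: simple_least_def)
  show "0 < alpha2 (rc_param \<xi> X)" if "X \<in> ?V" for X
    using pos[OF that] V(2)[OF that] by (simp add: par alpha2_proj)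
  show "Ck_on 2 (rc_model \<xi>) ?V (\<lambda>X. alpha2 (rc_param \<xi> X))"
  proof -
    have B: "Ck_on 2 (rc_model \<xi>) ?V (\<lambda>X. A + X)"
      by (intro Ck_on_add Ck_on_const Ck_on_ident)
    have "Ck_on 2 (rc_model \<xi>) ?V (\<lambda>X. least_sv_sq (A + X))"
      by (rule Ck_on_compose[OF _ B Ck_on_least_sv_sq]) (use V(1) in blast)
    then have "Ck_on 2 (rc_model \<xi>) ?V (\<lambda>X. ((A + X) \<bullet> (A + X)) * inverse (least_sv_sq (A + X)))"
      by (intro Ck_on_bilinear[OF bounded_bilinear_mult] Ck_on_bilinear[OF bounded_bilinear_inner]
          Ck_on_inverse B) (use pos in force)+
    then show ?thesis
      by (simp add: par alpha2_proj power2_norm_eq_inner divide_inverse)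
  qed
next
  fix I and \<gamma> :: "real \<Rightarrow> ('k^'m^'n) set"
  assume geo: "geodesic_on (conformal_chart alpha2 ` PGL_atlas) I \<gamma>"
  have *: "\<exists>A J c. norm A = 1 \<and> open J \<and> t \<in> J \<and>
      geodesic_in_chart (conformal_proj_chart (proj ` GL_simple) A) J c \<and> (\<forall>s\<in>J. \<gamma> s = proj (A + c s))"
    if t: "t \<in> I" for t
  proof -
    from geo t obtain \<xi> J c where \<xi>: "\<xi> \<in> conformal_chart alpha2 ` PGL_atlas"
      and J: "open J" "t \<in> J" "geodesic_in_chart \<xi> J c" "\<forall>s\<in>J. \<gamma> s = rc_param \<xi> (c s)"
      unfolding geodesic_on_def by fast
    from \<xi> obtain A where A: "norm A = 1" "\<xi> = conformal_proj_chart (proj ` GL_simple) A"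
      by (auto simp: PGL_atlas_def proj_atlas_def)
    have "rc_param \<xi> X = proj (A + X)" for X
      by (simp add: A(2) conformal_chart_def restrict_chart_def proj_chart_def)
    with J show ?thesis unfolding A(2) by (intro exI[of _ A] exI[of _ J] exI[of _ c] conjI A(1)) simp_all
  qed
  show "convex_on I (\<lambda>t. ln (alpha2 (\<gamma> t)))"
  proof (rule convex_on_real_if_lower_support)
    show "is_interval I" using geo by (simp add: geodesic_on_def)
    show "continuous_on I (\<lambda>t. ln (alpha2 (\<gamma> t)))"
    proof (intro continuous_at_imp_continuous_on ballI)
      fix t assume "t \<in> I"
      from *[OF this] obtain A J c where "norm A = 1" "open J" "t \<in> J"
        "geodesic_in_chart (conformal_proj_chart (proj ` GL_simple) A) J c" "\<forall>s\<in>J. \<gamma> s = proj (A + c s)"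
        by (elim exE conjE) (rule that)
      then show "isCont (\<lambda>t. ln (alpha2 (\<gamma> t))) t" by (rule ln_alpha2_lower_support(1))
    qed
    show "\<exists>p p' p''. (\<forall>\<^sub>F s in nhds t. (p has_real_derivative p' s) (at s) \<and> p s \<le> ln (alpha2 (\<gamma> s))) \<and>
      p t = ln (alpha2 (\<gamma> t)) \<and> (p' has_real_derivative p'') (at t) \<and> 0 \<le> p''" if t: "t \<in> I" for t
    proof -
      from *[OF t] obtain A J c where "norm A = 1" "open J" "t \<in> J"
        "geodesic_in_chart (conformal_proj_chart (proj ` GL_simple) A) J c" "\<forall>s\<in>J. \<gamma> s = proj (A + c s)"
        by (elim exE conjE) (rule that)
      then show ?thesis by (rule ln_alpha2_lower_support(2))
    qed
  qed
qed

theorem corollary7: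
  assumes "CARD('n::finite) \<le> CARD('m::finite)"
  shows "self_convex PGL_atlas (alpha2 :: (real^'m^'n) set \<Rightarrow> real) \<and>
         self_convex PGL_atlas (alpha2 :: (complex^'m^'n) set \<Rightarrow> real)"
  by (intro conjI self_convex_alpha2)

end
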